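(* Suppose that $U$, $f$ and $L$ satisfy the standing assumptions (1) and (2) listed in the context. Let $\boldsymbol{\mu},\boldsymbol{\nu}\in\mathbf{M}$ be relaxed controls, let $x$ and $p$ be the state trajectory and costate trajectory associated with $\boldsymbol{\mu}$, and for $\lambda\in[0,1]$ let $\boldsymbol{\mu}_\lambda:=\lambda\boldsymbol{\nu}+(1-\lambda)\boldsymbol{\mu}$ and $\tilde{J}(\lambda):=J(\boldsymbol{\mu}_\lambda)$. Then the one-sided (right) derivative $\frac{d\tilde{J}}{d\lambda^{+}}(0)$ exists and has the form $$\frac{d\tilde{J}}{d\lambda^{+}}(0)=\int_0^{t_f}\big(H(x(t),\nu(t),p(t))-H(x(t),\mu(t),p(t))\big)dt.$$
   Context: Setting. $U\subset\mathbb{R}^k$ is a compact set, $t_f>0$ and $x_0\in\mathbb{R}^n$ are fixed, $f$ is a function from $\mathbb{R}^n\times U$ to $\mathbb{R}^n$, and $L:\mathbb{R}^n\times U\to\mathbb{R}$ is an (absolutely integrable) cost function. Standing assumptions. (1) $f(x,u)$ is twice continuously differentiable in $x\in\mathbb{R}^n$ for every $u\in U$; the functions $f(x,u)$, $\frac{\partial f}{\partial x}(x,u)$ and $\frac{\partial^2 f}{\partial x^2}(x,u)$ are locally Lipschitz continuous in $(x,u)\in\mathbb{R}^n\times U$; and there exists $K>0$ such that $\|f(x,u)\|\le K(\|x\|+1)$ for every $x\in\mathbb{R}^n$ and $u\in U$. (2) $L(x,u)$ is continuously differentiable in $x\in\mathbb{R}^n$ for every $u\in U$; and $L(x,u)$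 and $\frac{\partial L}{\partial x}(x,u)$ are locally Lipschitz continuous in $(x,u)\in\mathbb{R}^n\times U$. Relaxed controls. $M$ is the space of Borel probability measures on $U$. A relaxed control is a mapping $\boldsymbol{\mu}=\{\mu(t):t\in[0,t_f]\}$ from $[0,t_f]$ to $M$ that is measurable in the sense that for every continuous $\phi:U\to\mathbb{R}$ the function $t\mapsto\int_U\phi(u)\,d\mu(t)$ is Lebesgue measurable. $\mathbf{M}$ is the space of relaxed controls; convex combinations of relaxed controls are taken pointwise in $t$, in the sense of measures. State, cost, costate. For $\boldsymbol{\mu}\in\mathbf{M}$, the state trajectory $x(t)$ is the absolutely continuous solution of $\dot{x}(t)=\int_U f(x(t),u)\,d\mu(t)$ with $x(0)=x_0$; the cost is $J(\boldsymbol{\mu})=\int_0^{t_f}\int_U L(x(t),u)\,d\mu(t)\,dt$; and the costate trajectory $p(t)\in\mathbb{R}^n$ is the solution of $$\dot{p}(t)=-\int_U\Big(\frac{\partial f}{\partial x}(x(t),u)^{\top}p(t)+\frac{\partial L}{\partial x}(x(t),u)^{\top}\Big)d\mu(t),\qquad p(t_f)=0.$$ Thus $\tilde{J}(\lambda)$ is the cost evaluated along the state trajectory $x_\lambda$ generated by $\boldsymbol{\mu}_\lambda$ from the same initial state $x_0$. Hamiltonian. For $x,p\in\mathbb{R}^n$ and $\nu\in M$, $H(x,\nu,p)=\int_U\big(p^{\top}f(x,u)+L(x,u)\big)d\nu$. *)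

theory Defs
  imports "HOL-Analysis.Analysis" "HOL-Probability.Probability_Measure"
begin

section \<open>Standing assumptions\<close>

definition locally_lipschitz_on ::
  "'a::metric_space set \<Rightarrow> ('a \<Rightarrow> 'b::metric_space) \<Rightarrow> bool" where
  "locally_lipschitz_on S g \<longleftrightarrow>
     (\<forall>z\<in>S. \<exists>r>0. \<exists>C. C-lipschitz_on (S \<inter> ball z r) g)"

definition Dx :: "(real^'n \<Rightarrow> 'u \<Rightarrow> real^'m) \<Rightarrow> real^'n \<Rightarrow> 'u \<Rightarrow> real^'n^'m" where
  "Dx f x u = jacobian (\<lambda>y. f y u) (at x)"

text \<open>The second derivative in the state is the derivative of the Jacobian matrix, a bounded
  linear map measured in the operator norm.\<close>

definition Dxx :: "(real^'n \<Rightarrow> 'u \<Rightarrow> real^'m) \<Rightarrow> real^'n \<Rightarrow> 'u \<Rightarrow> ((real^'n) \<Rightarrow>\<^sub>L (real^'n^'m))" where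
  "Dxx f x u = Blinfun (frechet_derivative (\<lambda>y. Dx f y u) (at x))"

text \<open>The gradient in the state, a column vector: the transpose of the row vector of partial
  derivatives.\<close>

definition gradx :: "(real^'n \<Rightarrow> 'u \<Rightarrow> real) \<Rightarrow> real^'n \<Rightarrow> 'u \<Rightarrow> real^'n" where
  "gradx L x u = (\<chi> i. frechet_derivative (\<lambda>y. L y u) (at x) (axis i 1))"

definition dynamics_assms :: "(real^'k) set \<Rightarrow> (real^'n \<Rightarrow> real^'k \<Rightarrow> real^'n) \<Rightarrow> bool" where
  "dynamics_assms U f \<longleftrightarrow>
     (\<forall>u\<in>U. (\<forall>x. (\<lambda>y. f y u) differentiable (at x)) \<and>
            (\<forall>x. (\<lambda>y. Dx f y u) differentiable (at x)) \<and>
            continuous_on UNIV (\<lambda>x. Dxx f x u)) \<and>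
     locally_lipschitz_on (UNIV \<times> U) (\<lambda>(x, u). f x u) \<and>
     locally_lipschitz_on (UNIV \<times> U) (\<lambda>(x, u). Dx f x u) \<and>
     locally_lipschitz_on (UNIV \<times> U) (\<lambda>(x, u). Dxx f x u) \<and>
     (\<exists>K>0. \<forall>x. \<forall>u\<in>U. norm (f x u) \<le> K * (norm x + 1))"

definition cost_assms :: "(real^'k) set \<Rightarrow> (real^'n \<Rightarrow> real^'k \<Rightarrow> real) \<Rightarrow> bool" where
  "cost_assms U L \<longleftrightarrow>
     (\<forall>u\<in>U. (\<forall>x. (\<lambda>y. L y u) differentiable (at x)) \<and>
            continuous_on UNIV (\<lambda>x. gradx L x u)) \<and>
     locally_lipschitz_on (UNIV \<times> U) (\<lambda>(x, u). L x u) \<and>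
     locally_lipschitz_on (UNIV \<times> U) (\<lambda>(x, u). gradx L x u)"

section \<open>Relaxed controls\<close>

definition prob_measures_on :: "'u::topological_space set \<Rightarrow> 'u measure set" where
  "prob_measures_on U = {m. prob_space m \<and> space m = U \<and> sets m = sets (restrict_space borel U)}"

text \<open>Values of a control outside the time interval are irrelevant and left unconstrained.\<close>

definition relaxed_control ::
  "'u::topological_space set \<Rightarrow> real \<Rightarrow> (real \<Rightarrow> 'u measure) \<Rightarrow> bool" where
  "relaxed_control U tf \<mu> \<longleftrightarrow>
     (\<forall>t\<in>{0..tf}. \<mu> t \<in> prob_measures_on U) \<and>
     (\<forall>\<phi> :: 'u \<Rightarrow> real. continuous_on U \<phi> \<longrightarrow>
        (\<lambda>t. \<integral>u. \<phi> u \<partial>\<mu> t) \<in> borel_measurable (lebesgue_on {0..tf}))"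

definition mix_measure :: "real \<Rightarrow> 'u measure \<Rightarrow> 'u measure \<Rightarrow> 'u measure" where
  "mix_measure l N M =
     measure_of (space M) (sets M) (\<lambda>A. ennreal l * emeasure N A + ennreal (1 - l) * emeasure M A)"

definition mix_control ::
  "real \<Rightarrow> (real \<Rightarrow> 'u measure) \<Rightarrow> (real \<Rightarrow> 'u measure) \<Rightarrow> real \<Rightarrow> 'u measure" where
  "mix_control l \<nu> \<mu> = (\<lambda>t. mix_measure l (\<nu> t) (\<mu> t))"

lemma space_mix_measure [simp]: "space (mix_measure l N M) = space M"
  and sets_mix_measure [simp]: "sets (mix_measure l N M) = sets M"
  by (simp_all add: mix_measure_def)

lemma emeasure_mix_measure:
  assumes "sets N = sets M" "A \<in> sets M"
  shows "emeasure (mix_measure l N M) A = ennreal l * emeasure N A + ennreal (1 - l) * emeasure M A"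
  unfolding mix_measure_def
proof (rule emeasure_measure_of_sigma)
  show "sigma_algebra (space M) (sets M)"
    by (rule sets.sigma_algebra_axioms)
  show "positive (sets M) (\<lambda>A. ennreal l * emeasure N A + ennreal (1 - l) * emeasure M A)"
    by (simp add: positive_def)
  show "countably_additive (sets M)
          (\<lambda>A. ennreal l * emeasure N A + ennreal (1 - l) * emeasure M A)"
  proof (rule countably_additiveI)
    fix B :: "nat \<Rightarrow> 'a set"
    assume B: "range B \<subseteq> sets M" "disjoint_family B" "(\<Union>i. B i) \<in> sets M"
    then have "(\<Sum>i. emeasure M (B i)) = emeasure M (\<Union>i. B i)"
      "(\<Sum>i. emeasure N (B i)) = emeasure N (\<Union>i. B i)"
      using assms(1) by (auto intro: suminf_emeasure)
    then show "(\<Sum>i. ennreal l * emeasure N (B i) + ennreal (1 - l) * emeasure M (B i)) =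
        ennreal l * emeasure N (\<Union>i. B i) + ennreal (1 - l) * emeasure M (\<Union>i. B i)"
      by (simp add: suminf_add[symmetric])
  qed
qed (use assms in simp)

lemma mix_measure_prob_measures_on:
  assumes "N \<in> prob_measures_on U" "M \<in> prob_measures_on U" "0 \<le> l" "l \<le> 1"
  shows "mix_measure l N M \<in> prob_measures_on U"
proof -
  have s: "sets N = sets M" "space N = space M"
    using assms by (auto simp: prob_measures_on_def)
  have "emeasure N (space N) = 1" "emeasure M (space M) = 1"
    using assms prob_space.emeasure_space_1 unfolding prob_measures_on_def by blast+
  then have "emeasure (mix_measure l N M) (space (mix_measure l N M)) = 1"
    using assms(3,4) s by (simp add: emeasure_mix_measure flip: ennreal_plus)
  then have "prob_space (mix_measure l N M)"
    by (rule prob_spaceI)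
  then show ?thesis
    using assms(2) by (simp add: prob_measures_on_def)
qed

section \<open>State, cost, costate, Hamiltonian\<close>

text \<open>Pointwise absolute continuity of a curve (the library only has absolute continuity
  of measures); \<open>D\<close> ranges over finite families of non-overlapping compact subintervals.\<close>

definition ac_on :: "real \<Rightarrow> real \<Rightarrow> (real \<Rightarrow> 'a::real_normed_vector) \<Rightarrow> bool" where
  "ac_on a b g \<longleftrightarrow>
     (\<forall>\<epsilon>>0. \<exists>\<delta>>0. \<forall>D T. D division_of T \<and> T \<subseteq> {a..b} \<and> (\<Sum>I\<in>D. Sup I - Inf I) < \<delta> \<longrightarrow>
        (\<Sum>I\<in>D. norm (g (Sup I) - g (Inf I))) < \<epsilon>)"

definition is_state_trajectory ::
  "(real^'n \<Rightarrow> real^'k \<Rightarrow> real^'n) \<Rightarrow> real \<Rightarrow> real^'n \<Rightarrow> (real \<Rightarrow> (real^'k) measure) \<Rightarrow>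
   (real \<Rightarrow> real^'n) \<Rightarrow> bool" where
  "is_state_trajectory f tf x0 \<mu> x \<longleftrightarrow>
     ac_on 0 tf x \<and> x 0 = x0 \<and>
     (AE t in lebesgue_on {0..tf}.
        (x has_vector_derivative (\<integral>u. f (x t) u \<partial>\<mu> t)) (at t within {0..tf}))"

text \<open>State trajectories are unique on the time interval only, and are arbitrary outside of it;
  hence the choice operator.\<close>

definition state_trajectory ::
  "(real^'n \<Rightarrow> real^'k \<Rightarrow> real^'n) \<Rightarrow> real \<Rightarrow> real^'n \<Rightarrow> (real \<Rightarrow> (real^'k) measure) \<Rightarrow>
   real \<Rightarrow> real^'n" where
  "state_trajectory f tf x0 \<mu> = (SOME x. is_state_trajectory f tf x0 \<mu> x)"

definition cost ::
  "(real^'n \<Rightarrow> real^'k \<Rightarrow> real^'n) \<Rightarrow> (real^'n \<Rightarrow> real^'k \<Rightarrow> real) \<Rightarrow> real \<Rightarrow> real^'n \<Rightarrow>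
   (real \<Rightarrow> (real^'k) measure) \<Rightarrow> real" where
  "cost f L tf x0 \<mu> =
     (\<integral>t. (\<integral>u. L (state_trajectory f tf x0 \<mu> t) u \<partial>\<mu> t) \<partial>lebesgue_on {0..tf})"

definition is_costate_trajectory ::
  "(real^'n \<Rightarrow> real^'k \<Rightarrow> real^'n) \<Rightarrow> (real^'n \<Rightarrow> real^'k \<Rightarrow> real) \<Rightarrow> real \<Rightarrow>
   (real \<Rightarrow> (real^'k) measure) \<Rightarrow> (real \<Rightarrow> real^'n) \<Rightarrow> (real \<Rightarrow> real^'n) \<Rightarrow> bool" where
  "is_costate_trajectory f L tf \<mu> x p \<longleftrightarrow>
     ac_on 0 tf p \<and> p tf = 0 \<and>
     (AE t in lebesgue_on {0..tf}.
        (p has_vector_derivative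
           - (\<integral>u. transpose (Dx f (x t) u) *v p t + gradx L (x t) u \<partial>\<mu> t)) (at t within {0..tf}))"

definition hamiltonian ::
  "(real^'n \<Rightarrow> real^'k \<Rightarrow> real^'n) \<Rightarrow> (real^'n \<Rightarrow> real^'k \<Rightarrow> real) \<Rightarrow>
   real^'n \<Rightarrow> (real^'k) measure \<Rightarrow> real^'n \<Rightarrow> real" where
  "hamiltonian f L x m p = (\<integral>u. p \<bullet> f x u + L x u \<partial>m)"

end

theory Submission
  imports Defs
begin

text \<open>
  The costate is the adjoint variable that removes the linearised state equation from the first
  variation. Let \<open>y\<close> be the trajectory of the mixture with weight \<open>l\<close>. Since \<open>y - x\<close> vanishes initially
  and \<open>p\<close> vanishes finally, the integral of the derivative of \<open>p \<bullet> (y - x)\<close> is zero, and it may be added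
  to the difference of the two costs. The state and costate equations turn the sum of the integrands
  into
  \<^item> \<open>l\<close> times the difference of the Hamiltonians for \<open>\<nu>\<close> and \<open>\<mu>\<close> at \<open>(x, p)\<close>, which is the asserted
    derivative,
  \<^item> plus the first-order Taylor remainder of \<open>p \<bullet> f + L\<close> between \<open>x\<close> and \<open>y\<close>, averaged over \<open>\<mu>\<close>, which is
    at most a constant times \<open>\<bar>y - x\<bar>\<^sup>2\<close>,
  \<^item> plus \<open>l\<close> times an error of order \<open>\<bar>y - x\<bar>\<close>, from moving the Hamiltonians from \<open>x\<close> to \<open>y\<close>.

  Gronwall's inequality gives \<open>\<bar>y - x\<bar> \<le> B l\<close>, so the cost of the mixture is its value at \<open>l = 0\<close> plus \<open>l\<close>
  times the asserted derivative up to an error of order \<open>l\<^sup>2\<close>; this is \<open>cost_expansion\<close>, with the pointwise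
  estimate in \<open>defect_le\<close>. The linear growth of \<open>f\<close> confines all states to one ball on which the data are
  Lipschitz uniformly in the control, and this makes all the constants independent of \<open>l\<close>.

  The cost is evaluated along a chosen state trajectory, so such a trajectory must be shown to exist
  for every mixture (\<open>state_trajectory_exists\<close>). It is the fixed point of a truncated Picard operator,
  and it satisfies the differential equation almost everywhere by Lebesgue differentiation.
  Conversely, absolutely continuous trajectories are handled through their integral equations
  (\<open>ac_on_has_integral\<close>).
\<close>

(* Below, content is the volume of a box, not the content of a polynomial. *)
hide_const (open) Polynomial.content

section \<open>Absolutely continuous curves\<close>

lemma sum_content_partial_tagged_division_le:
  fixes T :: "real set"
  assumes p: "p tagged_partial_division_of S"
    and sub: "\<Union>(snd ` p) \<subseteq> T" and T: "T \<in> lmeasurable"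
  shows "(\<Sum>K\<in>snd ` p. content K) \<le> measure lebesgue T"
proof -
  have div: "(snd ` p) division_of \<Union>(snd ` p)"
    by (rule partial_division_of_tagged_division[OF p])
  have "(\<Sum>K\<in>snd ` p. content K) = measure lebesgue (\<Union>(snd ` p))"
  proof -
    have "content K = measure lebesgue K" if "K \<in> snd ` p" for K
      using division_ofD(4)[OF div that] by auto
    then show ?thesis
      using content_division[OF div] by (metis (no_types, lifting) sum.cong)
  qed
  also have "\<dots> \<le> measure lebesgue T"
    using sub T lmeasurable_division[OF div]
    by (intro measure_mono_fmeasurable) auto
  finally show ?thesis .
qed

text \<open>The fundamental theorem of calculus for absolutely continuous curves, read off directly from the
  gauge integral. At tags outside the exceptional null set the derivative controls the increment, as
  in the classical case. At tags inside it the gauge confines the interval to an open set of small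
  measure, so that those intervals have small total length and absolute continuity makes the sum of
  their increments small.\<close>

lemma ac_on_has_integral:
  fixes g :: "real \<Rightarrow> 'a::banach"
  assumes "a \<le> b" and ac: "ac_on a b g" and N: "negligible N"
    and vd: "\<And>t. t \<in> {a..b} - N \<Longrightarrow> (g has_vector_derivative g' t) (at t within {a..b})"
  shows "(g' has_integral (g b - g a)) {a..b}"
proof -
  define h where "h t = (if t \<in> N then 0 else g' t)" for t
  have "(h has_integral (g b - g a)) {a..b}"
    unfolding has_integral_real
  proof (intro allI impI)
    fix e :: real assume "e > 0"
    \<comment> \<open>Half of \<open>e\<close> is spent on the tags outside \<open>N\<close>, half on those inside.\<close>
    define e1 where "e1 = e / (2 * (b - a + 1))"
    have e1: "e1 > 0" "e1 * (b - a) \<le> e / 2"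
      using \<open>a \<le> b\<close> \<open>e > 0\<close> by (auto simp: e1_def field_simps)
    obtain \<delta> where "\<delta> > 0" and \<delta>: "\<And>D T. D division_of T \<Longrightarrow> T \<subseteq> {a..b} \<Longrightarrow>
        (\<Sum>I\<in>D. Sup I - Inf I) < \<delta> \<Longrightarrow> (\<Sum>I\<in>D. norm (g (Sup I) - g (Inf I))) < e / 2"
      using ac \<open>e > 0\<close> unfolding ac_on_def by (metis half_gt_zero)
    obtain T where T: "open T" "N \<subseteq> T" "T \<in> lmeasurable" "measure lebesgue T < \<delta>"
    proof -
      obtain T where T: "open T" "N \<subseteq> T" "T - N \<in> lmeasurable" "emeasure lebesgue (T - N) < ennreal \<delta>"
        using sets_lebesgue_outer_open[OF negligible_imp_sets[OF N] \<open>\<delta> > 0\<close>] by blast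
      have lm: "T \<in> lmeasurable"
        using T N by (metis Un_Diff_cancel2 fmeasurable.Un negligible_imp_measurable sup.absorb1)
      have "measure lebesgue T = measure lebesgue (T - N)"
        using measure_Diff_null_set[of N lebesgue T] measure_Diff_null_set[of T lebesgue N] N lm
        by (metis fmeasurableD measure_Diff_null_set negligible_iff_null_sets)
      then show ?thesis
        using that T lm \<open>\<delta> > 0\<close> by (simp add: emeasure_eq_measure2 ennreal_less_iff)
    qed
    have "\<exists>d>0. t \<in> {a..b} - N \<longrightarrow>
        (\<forall>y\<in>{a..b}. norm (y - t) < d \<longrightarrow> norm (g y - g t - (y - t) *\<^sub>R g' t) \<le> e1 * norm (y - t))" for t
      using vd[unfolded has_vector_derivative_def has_derivative_within_alt] e1(1)
      by (metis zero_less_one)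
    then obtain d where d: "\<And>t. d t > 0"
      "\<And>t y. t \<in> {a..b} - N \<Longrightarrow> y \<in> {a..b} \<Longrightarrow> norm (y - t) < d t \<Longrightarrow>
         norm (g y - g t - (y - t) *\<^sub>R g' t) \<le> e1 * norm (y - t)"
      by metis
    define \<gamma> where "\<gamma> t = (if t \<in> N then T else ball t (d t))" for t
    have gauge: "gauge \<gamma>"
      using T d(1) by (auto simp: gauge_def \<gamma>_def)
    have est: "norm ((\<Sum>(t, K)\<in>p. content K *\<^sub>R h t) - (g b - g a)) < e"
      if p: "p tagged_division_of {a..b}" "\<gamma> fine p" for p
    proof -
      define r where "r = (\<lambda>(t::real, K). content K *\<^sub>R h t - (g (Sup K) - g (Inf K)))"
      have fin: "finite p"
        using p(1) by blast
      have pK: "\<exists>u v. K = {u..v} \<and> u \<le> v \<and> t \<in> K \<and> K \<subseteq> {a..b} \<and> K \<subseteq> \<gamma> t" if "(t, K) \<in> p" for t K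
      proof -
        obtain u v where "K = cbox u v"
          using p(1) \<open>(t, K) \<in> p\<close> by (meson tagged_division_ofD(4))
        moreover have "t \<in> K" "K \<subseteq> {a..b}" "K \<subseteq> \<gamma> t"
          using tagged_division_ofD(2,3)[OF p(1) that] fineD[OF p(2) that] by auto
        ultimately show ?thesis by auto
      qed
      define p2 where "p2 = {(t, K) \<in> p. t \<in> N}"
      have p2: "p2 \<subseteq> p" by (auto simp: p2_def)
      have "(\<Sum>(t, K)\<in>p. content K *\<^sub>R h t) - (g b - g a) = sum r p"
        using additive_tagged_division_1[OF \<open>a \<le> b\<close> p(1), of g]
        by (simp add: r_def sum_subtractf case_prod_unfold)
      also have "\<dots> = sum r (p - p2) + sum r p2"
        using sum.subset_diff[OF p2 fin] .
      finally have "norm ((\<Sum>(t, K)\<in>p. content K *\<^sub>R h t) - (g b - g a)) \<le> norm (sum r (p - p2)) + norm (sum r p2)"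
        by (metis norm_triangle_ineq)
      moreover have "norm (sum r (p - p2)) \<le> e / 2"
      proof -
        have "norm (sum r (p - p2)) \<le> (\<Sum>(t, K)\<in>p - p2. e1 * content K)"
        proof (rule sum_norm_le, safe)
          fix t K assume tK: "(t, K) \<in> p" "(t, K) \<notin> p2"
          then obtain u v where uv: "K = {u..v}" "u \<le> v" "t \<in> K" "K \<subseteq> {a..b}" "K \<subseteq> \<gamma> t"
            using pK by blast
          have tN: "t \<notin> N"
            using tK by (auto simp: p2_def)
          have *: "norm (g y - g t - (y - t) *\<^sub>R g' t) \<le> e1 * norm (y - t)" if "y \<in> K" for y
            using uv tN that by (intro d) (auto simp: \<gamma>_def dist_real_def subset_iff abs_minus_commute)
          have "r (t, K) = (g u - g t - (u - t) *\<^sub>R g' t) - (g v - g t - (v - t) *\<^sub>R g' t)"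
            using uv tN by (simp add: r_def h_def algebra_simps)
          then have "norm (r (t, K)) \<le> norm (g u - g t - (u - t) *\<^sub>R g' t) + norm (g v - g t - (v - t) *\<^sub>R g' t)"
            by (metis norm_triangle_ineq4)
          also have "\<dots> \<le> e1 * norm (u - t) + e1 * norm (v - t)"
            using uv by (intro add_mono *) auto
          also have "\<dots> = e1 * content K"
            using uv by (simp add: algebra_simps)
          finally show "norm (r (t, K)) \<le> e1 * content K" .
        qed
        also have "\<dots> \<le> (\<Sum>(t, K)\<in>p. e1 * content K)"
          using e1 fin by (intro sum_mono2) auto
        also have "\<dots> = e1 * (\<Sum>(t, K)\<in>p. content K)"
          by (simp add: sum_distrib_left case_prod_unfold)
        also have "\<dots> = e1 * (b - a)"
          using additive_content_tagged_division[of p a b] p(1) \<open>a \<le> b\<close> by simp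
        finally show ?thesis using e1 by simp
      qed
      moreover have "norm (sum r p2) < e / 2"
      proof -
        have ptag: "p2 tagged_partial_division_of {a..b}"
          using p(1) p2 by (meson tagged_division_of_def tagged_partial_division_subset)
        have sub: "\<Union>(snd ` p2) \<subseteq> {a..b}" "\<Union>(snd ` p2) \<subseteq> T"
          using pK by (fastforce simp: p2_def \<gamma>_def)+
        have "t \<in> K" if "(t, K) \<in> p2" for t K
          using tagged_division_ofD(2)[OF p(1)] that p2 by blast
        then have ne: "K \<noteq> {}" if "(t, K) \<in> p2" for t K
          using that by fastforce
        have "norm (sum r p2) \<le> (\<Sum>(t, K)\<in>p2. norm (g (Sup K) - g (Inf K)))"
          by (rule sum_norm_le) (auto simp: r_def p2_def h_def norm_minus_commute)
        \<comment> \<open>Reindexing by the intervals needs a summand that vanishes on every box with empty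
            interior, hence also on the empty one, on which \<open>Sup\<close> and \<open>Inf\<close> carry no meaning.\<close>
        also have "\<dots> = (\<Sum>(t, K)\<in>p2. if K = {} then 0 else norm (g (Sup K) - g (Inf K)))"
          by (rule sum.cong[OF refl]) (clarsimp simp: ne)
        also have "\<dots> = (\<Sum>K\<in>snd ` p2. if K = {} then 0 else norm (g (Sup K) - g (Inf K)))"
          by (rule sum.over_tagged_division_lemma[OF tagged_partial_division_of_Union_self[OF ptag]]) auto
        also have "\<dots> = (\<Sum>K\<in>snd ` p2. norm (g (Sup K) - g (Inf K)))"
          by (rule sum.cong[OF refl]) (clarsimp, metis ne)
        also have "\<dots> < e / 2"
        proof (rule \<delta>[OF partial_division_of_tagged_division[OF ptag] sub(1)])
          have "(\<Sum>K\<in>snd ` p2. Sup K - Inf K) = (\<Sum>K\<in>snd ` p2. content K)"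
            using pK p2 by (intro sum.cong) fastforce+
          also have "\<dots> \<le> measure lebesgue T"
            by (rule sum_content_partial_tagged_division_le[OF ptag sub(2) T(3)])
          finally show "(\<Sum>K\<in>snd ` p2. Sup K - Inf K) < \<delta>"
            using T(4) by simp
        qed
        finally show ?thesis .
      qed
      ultimately show ?thesis by linarith
    qed
    show "\<exists>\<gamma>. gauge \<gamma> \<and> (\<forall>p. p tagged_division_of {a..b} \<and> \<gamma> fine p \<longrightarrow>
        norm ((\<Sum>(t, K)\<in>p. content K *\<^sub>R h t) - (g b - g a)) < e)"
      by (rule exI[of _ \<gamma>], rule conjI, rule gauge, intro allI impI, elim conjE, rule est)
  qed
  then show ?thesis
    by (rule has_integral_spike[OF N, rotated]) (auto simp: h_def)
qed

lemma ac_on_subinterval: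
  assumes "ac_on a b g" "a \<le> c" "d \<le> b"
  shows "ac_on c d g"
proof -
  have "{c..d} \<subseteq> {a..b}"
    using assms by auto
  then show ?thesis
    using assms(1) unfolding ac_on_def by (meson subset_trans)
qed

lemma ac_on_lipschitz:
  fixes g :: "real \<Rightarrow> 'a::real_normed_vector"
  assumes "\<And>s t. a \<le> s \<Longrightarrow> s \<le> t \<Longrightarrow> t \<le> b \<Longrightarrow> norm (g t - g s) \<le> B * (t - s)"
  shows "ac_on a b g"
  unfolding ac_on_def
proof (intro allI impI)
  fix e :: real assume "e > 0"
  define B1 where "B1 = \<bar>B\<bar> + 1"
  have "B1 > 0" by (simp add: B1_def)
  show "\<exists>\<delta>>0. \<forall>D T. D division_of T \<and> T \<subseteq> {a..b} \<and> (\<Sum>I\<in>D. Sup I - Inf I) < \<delta> \<longrightarrow>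
        (\<Sum>I\<in>D. norm (g (Sup I) - g (Inf I))) < e"
  proof (intro exI[of _ "e / B1"] conjI allI impI; (elim conjE)?)
    show "e / B1 > 0" using \<open>e > 0\<close> \<open>B1 > 0\<close> by simp
    fix D T assume D: "D division_of T" "T \<subseteq> {a..b}" and less: "(\<Sum>I\<in>D. Sup I - Inf I) < e / B1"
    have "(\<Sum>I\<in>D. norm (g (Sup I) - g (Inf I))) \<le> (\<Sum>I\<in>D. B1 * (Sup I - Inf I))"
    proof (rule sum_mono)
      fix I assume I: "I \<in> D"
      obtain u v where uv: "I = cbox u v"
        using division_ofD(4)[OF D(1) I] by blast
      then have "u \<le> v" "a \<le> u" "v \<le> b"
        using division_ofD(2,3)[OF D(1) I] D(2) by (auto simp: subset_iff)
      then have "norm (g v - g u) \<le> B * (v - u)" "B * (v - u) \<le> B1 * (v - u)"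
        using assms by (auto simp: B1_def intro!: mult_right_mono)
      then show "norm (g (Sup I) - g (Inf I)) \<le> B1 * (Sup I - Inf I)"
        using uv \<open>u \<le> v\<close> by simp
    qed
    also have "\<dots> < e"
      using less \<open>B1 > 0\<close> by (simp only: sum_distrib_left[symmetric] pos_less_divide_eq mult.commute)
    finally show "(\<Sum>I\<in>D. norm (g (Sup I) - g (Inf I))) < e" .
  qed
qed

lemma ac_on_continuous_on:
  fixes g :: "real \<Rightarrow> 'a::real_normed_vector"
  assumes "ac_on a b g"
  shows "continuous_on {a..b} g"
  unfolding continuous_on_iff
proof (intro ballI allI impI)
  fix s e :: real assume s: "s \<in> {a..b}" and "e > 0"
  obtain \<delta> where "\<delta> > 0" and \<delta>: "\<And>D T. D division_of T \<Longrightarrow> T \<subseteq> {a..b} \<Longrightarrow>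
        (\<Sum>I\<in>D. Sup I - Inf I) < \<delta> \<Longrightarrow> (\<Sum>I\<in>D. norm (g (Sup I) - g (Inf I))) < e"
    using assms \<open>e > 0\<close> unfolding ac_on_def by metis
  have *: "norm (g v - g u) < e" if "u \<in> {a..b}" "v \<in> {a..b}" "u \<le> v" "v - u < \<delta>" for u v
    using \<delta>[OF division_of_self[of u v]] that by auto
  have "dist (g t) (g s) < e" if "t \<in> {a..b}" "dist t s < \<delta>" for t
    using *[of t s] *[of s t] that s
    by (cases "t \<le> s") (auto simp: dist_norm norm_minus_commute)
  then show "\<exists>d>0. \<forall>t\<in>{a..b}. dist t s < d \<longrightarrow> dist (g t) (g s) < e"
    using \<open>\<delta> > 0\<close> by blast
qed

text \<open>For differences and inner products of absolutely continuous curves, whose increments are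
  dominated by those of the two curves.\<close>

lemma ac_on_dominated:
  fixes f :: "real \<Rightarrow> 'a::real_normed_vector" and g :: "real \<Rightarrow> 'b::real_normed_vector"
    and h :: "real \<Rightarrow> 'c::real_normed_vector"
  assumes f: "ac_on a b f" and g: "ac_on a b g" and "0 < B"
    and le: "\<And>u v. u \<in> {a..b} \<Longrightarrow> v \<in> {a..b} \<Longrightarrow> norm (h v - h u) \<le> B * (norm (f v - f u) + norm (g v - g u))"
  shows "ac_on a b h"
  unfolding ac_on_def
proof (intro allI impI)
  fix e :: real assume "e > 0"
  then have "e / (2 * B) > 0" using \<open>0 < B\<close> by simp
  obtain \<delta>1 where "\<delta>1 > 0" and 1: "\<And>D T. D division_of T \<Longrightarrow> T \<subseteq> {a..b} \<Longrightarrow>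
        (\<Sum>I\<in>D. Sup I - Inf I) < \<delta>1 \<Longrightarrow> (\<Sum>I\<in>D. norm (f (Sup I) - f (Inf I))) < e / (2 * B)"
    using f \<open>e / (2 * B) > 0\<close> unfolding ac_on_def by metis
  obtain \<delta>2 where "\<delta>2 > 0" and 2: "\<And>D T. D division_of T \<Longrightarrow> T \<subseteq> {a..b} \<Longrightarrow>
        (\<Sum>I\<in>D. Sup I - Inf I) < \<delta>2 \<Longrightarrow> (\<Sum>I\<in>D. norm (g (Sup I) - g (Inf I))) < e / (2 * B)"
    using g \<open>e / (2 * B) > 0\<close> unfolding ac_on_def by metis
  show "\<exists>\<delta>>0. \<forall>D T. D division_of T \<and> T \<subseteq> {a..b} \<and> (\<Sum>I\<in>D. Sup I - Inf I) < \<delta> \<longrightarrow>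
        (\<Sum>I\<in>D. norm (h (Sup I) - h (Inf I))) < e"
  proof (intro exI[of _ "min \<delta>1 \<delta>2"] conjI allI impI; (elim conjE)?)
    show "min \<delta>1 \<delta>2 > 0" using \<open>\<delta>1 > 0\<close> \<open>\<delta>2 > 0\<close> by simp
    fix D T assume D: "D division_of T" "T \<subseteq> {a..b}" and less: "(\<Sum>I\<in>D. Sup I - Inf I) < min \<delta>1 \<delta>2"
    have "(\<Sum>I\<in>D. norm (h (Sup I) - h (Inf I))) \<le>
        (\<Sum>I\<in>D. B * (norm (f (Sup I) - f (Inf I)) + norm (g (Sup I) - g (Inf I))))"
    proof (rule sum_mono)
      fix I assume I: "I \<in> D"
      obtain u v where uv: "I = cbox u v"
        using division_ofD(4)[OF D(1) I] by blast
      then have "u \<le> v" "a \<le> u" "v \<le> b"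
        using division_ofD(2,3)[OF D(1) I] D(2) by (auto simp: subset_iff)
      then show "norm (h (Sup I) - h (Inf I)) \<le> B * (norm (f (Sup I) - f (Inf I)) + norm (g (Sup I) - g (Inf I)))"
        using uv le[of u v] by simp
    qed
    also have "\<dots> = B * ((\<Sum>I\<in>D. norm (f (Sup I) - f (Inf I))) + (\<Sum>I\<in>D. norm (g (Sup I) - g (Inf I))))"
      by (simp only: sum_distrib_left[symmetric] sum.distrib)
    also have "\<dots> < B * (e / (2 * B) + e / (2 * B))"
      using 1[OF D] 2[OF D] less \<open>0 < B\<close> by (intro mult_strict_left_mono add_strict_mono) auto
    also have "\<dots> = e" using \<open>0 < B\<close> by simp
    finally show "(\<Sum>I\<in>D. norm (h (Sup I) - h (Inf I))) < e" .
  qed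
qed

lemma ac_on_diff:
  fixes f g :: "real \<Rightarrow> 'a::real_normed_vector"
  assumes "ac_on a b f" "ac_on a b g"
  shows "ac_on a b (\<lambda>t. f t - g t)"
proof (rule ac_on_dominated[OF assms, of 1])
  fix u v
  have "f v - g v - (f u - g u) = (f v - f u) - (g v - g u)"
    by simp
  then show "norm (f v - g v - (f u - g u)) \<le> 1 * (norm (f v - f u) + norm (g v - g u))"
    by (metis mult_1 norm_triangle_ineq4)
qed simp

lemma compact_continuous_norm_bound:
  fixes \<phi> :: "'u::metric_space \<Rightarrow> 'b::real_normed_vector"
  assumes "compact S" "continuous_on S \<phi>"
  obtains B where "0 \<le> B" "\<And>z. z \<in> S \<Longrightarrow> norm (\<phi> z) \<le> B"
proof -
  have "bounded (\<phi> ` S)"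
    using assms by (intro compact_imp_bounded compact_continuous_image)
  then obtain B where "B > 0" "\<forall>y\<in>\<phi> ` S. norm y \<le> B"
    by (meson bounded_pos)
  then show ?thesis
    by (intro that[of B]) auto
qed

lemma ac_on_inner:
  fixes f g :: "real \<Rightarrow> 'a::real_inner"
  assumes "ac_on a b f" "ac_on a b g"
  shows "ac_on a b (\<lambda>t. f t \<bullet> g t)"
proof -
  obtain B1 B2 where B: "0 \<le> B1" "\<And>t. t \<in> {a..b} \<Longrightarrow> norm (f t) \<le> B1"
    "0 \<le> B2" "\<And>t. t \<in> {a..b} \<Longrightarrow> norm (g t) \<le> B2"
    using compact_continuous_norm_bound[OF compact_Icc ac_on_continuous_on[OF assms(1)]]
      compact_continuous_norm_bound[OF compact_Icc ac_on_continuous_on[OF assms(2)]] by metis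
  show ?thesis
  proof (rule ac_on_dominated[OF assms, of "B1 + B2 + 1"])
    fix u v assume uv: "u \<in> {a..b}" "v \<in> {a..b}"
    have bnd: "norm (g v) \<le> B1 + B2 + 1" "norm (f u) \<le> B1 + B2 + 1"
      using B(1,3) B(2)[OF uv(1)] B(4)[OF uv(2)] by linarith+
    have "norm (f v \<bullet> g v - f u \<bullet> g u) = norm ((f v - f u) \<bullet> g v + f u \<bullet> (g v - g u))"
      by (simp add: inner_diff_left inner_diff_right)
    also have "\<dots> \<le> norm (f v - f u) * norm (g v) + norm (f u) * norm (g v - g u)"
      using Cauchy_Schwarz_ineq2 by (intro norm_triangle_le add_mono) auto
    also have "\<dots> \<le> norm (f v - f u) * (B1 + B2 + 1) + (B1 + B2 + 1) * norm (g v - g u)"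
      using bnd by (intro add_mono mult_left_mono mult_right_mono) auto
    finally show "norm (f v \<bullet> g v - f u \<bullet> g u) \<le> (B1 + B2 + 1) * (norm (f v - f u) + norm (g v - g u))"
      by (simp add: algebra_simps)
  qed (use B in simp)
qed

lemma AE_lebesgue_on_obtain_negligible:
  fixes S :: "real set"
  assumes "AE t in lebesgue_on S. P t" "S \<in> sets lebesgue"
  obtains N where "negligible N" "\<And>t. t \<in> S - N \<Longrightarrow> P t"
proof -
  have "AE t in lebesgue. t \<in> S \<longrightarrow> P t"
    using assms by (simp add: AE_restrict_space_iff)
  then obtain N where "N \<in> null_sets lebesgue" "{t. \<not> (t \<in> S \<longrightarrow> P t)} \<subseteq> N"
    by (auto simp: eventually_ae_filter)
  then show ?thesis
    by (intro that[of N]) (auto simp: negligible_iff_null_sets)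
qed

lemma AE_lebesgue_onI_negligible:
  fixes S :: "real set"
  assumes "negligible N" "\<And>t. t \<in> S - N \<Longrightarrow> P t" "S \<in> sets lebesgue"
  shows "AE t in lebesgue_on S. P t"
proof -
  have "AE t in lebesgue. t \<in> S \<longrightarrow> P t"
    using assms by (intro AE_I'[of N]) (auto simp: negligible_iff_null_sets)
  then show ?thesis
    using assms by (simp add: AE_restrict_space_iff)
qed

lemma ac_on_AE_has_integral:
  fixes g :: "real \<Rightarrow> 'a::banach"
  assumes ac: "ac_on a b g"
    and vd: "AE t in lebesgue_on {a..b}. (g has_vector_derivative g' t) (at t within {a..b})"
    and st: "a \<le> s" "s \<le> t" "t \<le> b"
  shows "(g' has_integral (g t - g s)) {s..t}"
proof -
  obtain N where N: "negligible N"
    "\<And>t. t \<in> {a..b} - N \<Longrightarrow> (g has_vector_derivative g' t) (at t within {a..b})"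
    using AE_lebesgue_on_obtain_negligible[OF vd] by auto
  show ?thesis
  proof (rule ac_on_has_integral[OF \<open>s \<le> t\<close> ac_on_subinterval[OF ac] N(1)])
    fix r assume "r \<in> {s..t} - N"
    then show "(g has_vector_derivative g' r) (at r within {s..t})"
      using st by (intro has_vector_derivative_within_subset[OF N(2)]) auto
  qed (use st in auto)
qed

lemma has_integral_norm_le_interval:
  fixes h :: "real \<Rightarrow> 'a::real_normed_vector"
  assumes "(h has_integral i) {s..t}" "s \<le> t" "\<And>r. r \<in> {s..t} \<Longrightarrow> norm (h r) \<le> B"
  shows "norm i \<le> B * (t - s)"
proof -
  have "0 \<le> B"
    using assms(3)[of s] assms(2) norm_ge_zero[of "h s"] by (meson atLeastAtMost_iff order_refl order_trans)
  then show ?thesis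
    using has_integral_bound[of B h i s t] assms by simp
qed

text \<open>One-sided Lebesgue differentiation on the line: the one-dimensional case of the statement that
  the averages over small cubes with corner \<open>t\<close> converge to the value at \<open>t\<close>, for almost every \<open>t\<close>.\<close>

lemma AE_right_derivative_indefinite_integral:
  fixes f :: "real \<Rightarrow> 'a::euclidean_space"
  assumes "\<And>a b. f integrable_on {a..b}"
  obtains N where "negligible N"
    "\<And>t e. t \<notin> N \<Longrightarrow> 0 < e \<Longrightarrow> \<exists>d>0. \<forall>h. 0 < h \<and> h < d \<longrightarrow>
       norm (integral {t..t + h} f - h *\<^sub>R f t) \<le> e * h"
proof -
  obtain N where N: "negligible N"
    "\<And>x e. \<lbrakk>x \<notin> N; 0 < e\<rbrakk> \<Longrightarrow> \<exists>d>0. \<forall>h. 0 < h \<and> h < d \<longrightarrow>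
         norm(integral (cbox x (x + h *\<^sub>R One)) f /\<^sub>R h ^ DIM(real) - f x) < e"
    using integrable_ccontinuous_explicit[of f] assms by (metis box_real(2))
  show thesis
  proof (rule that[OF N(1)])
    fix t e :: real assume "t \<notin> N" "0 < e"
    then obtain d where d: "d > 0" "\<And>h. 0 < h \<Longrightarrow> h < d \<Longrightarrow> norm (integral {t..t + h} f /\<^sub>R h - f t) < e"
      using N(2)[of t e] by auto
    have "norm (integral {t..t + h} f - h *\<^sub>R f t) \<le> e * h" if "0 < h" "h < d" for h
    proof -
      have "integral {t..t + h} f - h *\<^sub>R f t = h *\<^sub>R (integral {t..t + h} f /\<^sub>R h - f t)"
        using that by (simp add: algebra_simps)
      then have "norm (integral {t..t + h} f - h *\<^sub>R f t) = h * norm (integral {t..t + h} f /\<^sub>R h - f t)"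
        using that by simp
      also have "\<dots> \<le> h * e"
        using d(2)[OF that] that by (intro mult_left_mono) auto
      finally show ?thesis by (simp add: mult.commute)
    qed
    then show "\<exists>d>0. \<forall>h. 0 < h \<and> h < d \<longrightarrow> norm (integral {t..t + h} f - h *\<^sub>R f t) \<le> e * h"
      using \<open>d > 0\<close> by blast
  qed
qed

text \<open>Lebesgue differentiation. The left derivative comes from the right derivative of the reflected
  integrand.\<close>

lemma AE_has_vector_derivative_indefinite_integral:
  fixes f :: "real \<Rightarrow> 'a::euclidean_space"
  assumes f: "f integrable_on {a..b}"
  shows "AE t in lebesgue_on {a..b}.
    ((\<lambda>s. c + integral {a..s} f) has_vector_derivative f t) (at t within {a..b})"
proof -
  define f0 where "f0 t = (if t \<in> {a..b} then f t else 0)" for t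
  have "f0 integrable_on UNIV"
    using f unfolding f0_def by (subst integrable_restrict_UNIV)
  then have f0: "f0 integrable_on {u..v}" for u v
    by (rule integrable_on_subinterval) auto
  then have f0r: "(\<lambda>t. f0 (- t)) integrable_on {u..v}" for u v
    using Henstock_Kurzweil_Integration.integrable_reflect_real[where f = f0 and a = "- v" and b = "- u"] by simp
  obtain N1 where N1: "negligible N1"
    "\<And>t e. t \<notin> N1 \<Longrightarrow> 0 < e \<Longrightarrow> \<exists>d>0. \<forall>h. 0 < h \<and> h < d \<longrightarrow>
       norm (integral {t..t + h} f0 - h *\<^sub>R f0 t) \<le> e * h"
    using AE_right_derivative_indefinite_integral[OF f0] by metis
  obtain N2 where N2: "negligible N2"
    "\<And>t e. t \<notin> N2 \<Longrightarrow> 0 < e \<Longrightarrow> \<exists>d>0. \<forall>h. 0 < h \<and> h < d \<longrightarrow>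
       norm (integral {t..t + h} (\<lambda>t. f0 (- t)) - h *\<^sub>R f0 (- t)) \<le> e * h"
    using AE_right_derivative_indefinite_integral[OF f0r] by metis
  have "negligible {t. - t \<in> N2}"
    unfolding negligible_def
  proof (intro allI)
    fix u v :: real
    have "(indicat_real N2 has_integral 0) {-v..-u}"
      using N2(1) unfolding negligible_def by (metis box_real(2))
    then have "((\<lambda>t. indicat_real N2 (- t)) has_integral 0) {u..v}"
      using has_integral_reflect_real[where f = "indicat_real N2" and i = 0 and a = "- v" and b = "- u"] by simp
    moreover have "(\<lambda>t. indicat_real N2 (- t)) = indicat_real {t. - t \<in> N2}"
      by (auto simp: indicator_def)
    ultimately show "(indicat_real {t. - t \<in> N2} has_integral 0) (cbox u v)"
      by simp
  qed
  then have "negligible (N1 \<union> {t. - t \<in> N2})"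
    using N1(1) by simp
  then show ?thesis
  proof (rule AE_lebesgue_onI_negligible)
    fix t assume t: "t \<in> {a..b} - (N1 \<union> {t. - t \<in> N2})"
    then have t1: "t \<notin> N1" and t2: "- t \<notin> N2"
      by auto
    have eq: "integral {u..v} f = integral {u..v} f0" if "a \<le> u" "v \<le> b" for u v
      using that by (intro integral_cong) (auto simp: f0_def)
    have split: "integral {a..v} f - integral {a..u} f = integral {u..v} f" if "a \<le> u" "u \<le> v" "v \<le> b" for u v
      using Henstock_Kurzweil_Integration.integral_combine[of a u v f] integrable_on_subinterval[OF f, of a v] that
      by (auto simp: algebra_simps)
    show "((\<lambda>s. c + integral {a..s} f) has_vector_derivative f t) (at t within {a..b})"
      unfolding has_vector_derivative_def has_derivative_within_alt
    proof (intro conjI allI impI)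
      show "bounded_linear (\<lambda>x. x *\<^sub>R f t)"
        by (rule bounded_linear_scaleR_left)
      fix e :: real assume "0 < e"
      obtain d1 where d1: "d1 > 0" "\<And>h. 0 < h \<Longrightarrow> h < d1 \<Longrightarrow> norm (integral {t..t + h} f0 - h *\<^sub>R f0 t) \<le> e * h"
        using N1(2)[OF t1 \<open>0 < e\<close>] by blast
      obtain d2 where d2: "d2 > 0" "\<And>h. 0 < h \<Longrightarrow> h < d2 \<Longrightarrow>
          norm (integral {-t..-t + h} (\<lambda>t. f0 (- t)) - h *\<^sub>R f0 t) \<le> e * h"
        using N2(2)[OF t2 \<open>0 < e\<close>] by auto
      have "norm (integral {a..s} f - integral {a..t} f - (s - t) *\<^sub>R f t) \<le> e * \<bar>s - t\<bar>"
        if s: "s \<in> {a..b}" "\<bar>s - t\<bar> < min d1 d2" for s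
      proof -
        have ft: "f0 t = f t" using t by (simp add: f0_def)
        consider "s = t" | "t < s" | "s < t" by linarith
        then show ?thesis
        proof cases
          case 2
          then show ?thesis
            using d1(2)[of "s - t"] s t split[of t s] eq[of t s] ft by auto
        next
          case 3
          have "integral {-t..-s} (\<lambda>t. f0 (- t)) = integral {s..t} f0"
            by simp
          then have "norm (integral {s..t} f - (t - s) *\<^sub>R f t) \<le> e * (t - s)"
            using d2(2)[of "t - s"] s t 3 eq[of s t] ft by auto
          moreover have "integral {a..s} f - integral {a..t} f - (s - t) *\<^sub>R f t = - (integral {s..t} f - (t - s) *\<^sub>R f t)"
            using split[of s t] s t 3 by (simp add: algebra_simps)
          ultimately show ?thesis using 3 by (metis abs_minus_commute abs_of_pos diff_gt_0_iff_gt norm_minus_cancel)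
        qed simp
      qed
      then show "\<exists>d>0. \<forall>s\<in>{a..b}. norm (s - t) < d \<longrightarrow>
          norm (c + integral {a..s} f - (c + integral {a..t} f) - (s - t) *\<^sub>R f t) \<le> e * norm (s - t)"
        using d1(1) d2(1) by (intro exI[of _ "min d1 d2"]) auto
    qed
  qed simp
qed

section \<open>The Gronwall inequality and integral equations\<close>

text \<open>At a point \<open>s\<close> where \<open>z(s) exp(-2Cs)\<close> has a nonnegative maximum, the integral of \<open>z\<close> is at most
  half of \<open>z(s)/C\<close>, so the integral term of the hypothesis can be absorbed on the left. The price is
  the factor two and the doubled exponent.\<close>

lemma gronwall_integral:
  fixes z :: "real \<Rightarrow> real"
  assumes "0 < C" "0 \<le> A" "0 \<le> T" and cont: "continuous_on {0..T} z"
    and le: "\<And>t. t \<in> {0..T} \<Longrightarrow> z t \<le> A + C * integral {0..t} z"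
    and t: "t \<in> {0..T}"
  shows "z t \<le> 2 * A * exp (2 * C * t)"
proof -
  define w where "w s = z s * exp (- (2 * C * s))" for s
  have "continuous_on {0..T} w"
    unfolding w_def by (intro continuous_intros cont)
  then obtain s where s: "s \<in> {0..T}" and max: "\<And>r. r \<in> {0..T} \<Longrightarrow> w r \<le> w s"
    using continuous_attains_sup[of "{0..T}" w] \<open>0 \<le> T\<close> by auto
  have z_le: "z r \<le> w s * exp (2 * C * r)" if "r \<in> {0..T}" for r
    using max[OF that] by (simp add: w_def exp_minus field_simps)
  have w_int: "((\<lambda>r. w s * exp (2 * C * r)) has_integral
      w s * exp (2 * C * s) / (2 * C) - w s * exp (2 * C * 0) / (2 * C)) {0..s}"
    using s \<open>0 < C\<close> by (intro fundamental_theorem_of_calculus)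
      (auto simp: has_real_derivative_iff_has_vector_derivative[symmetric] intro!: derivative_eq_intros)
  have z_int: "(z has_integral integral {0..s} z) {0..s}"
    using s by (intro integrable_integral integrable_continuous_real continuous_on_subset[OF cont]) auto
  have "integral {0..s} z \<le> w s * exp (2 * C * s) / (2 * C) - w s / (2 * C)"
    using has_integral_le[OF z_int w_int] z_le s by simp
  then have "C * integral {0..s} z \<le> (w s * exp (2 * C * s) - w s) / 2"
    using \<open>0 < C\<close> by (simp add: field_simps)
  moreover have "z s \<le> A + C * integral {0..s} z"
    by (rule le[OF s])
  moreover have "z s = w s * exp (2 * C * s)"
    by (simp add: w_def exp_minus)
  ultimately have zs: "w s * (exp (2 * C * s) + 1) \<le> 2 * A"
    by (simp add: algebra_simps)
  have "w s \<le> 2 * A"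
  proof (cases "w s \<ge> 0")
    case True
    then have "w s * 1 \<le> w s * (exp (2 * C * s) + 1)"
      by (intro mult_left_mono) auto
    then show ?thesis using zs by simp
  next
    case False
    then show ?thesis using \<open>0 \<le> A\<close> by simp
  qed
  then have "w s * exp (2 * C * t) \<le> 2 * A * exp (2 * C * t)"
    by (intro mult_right_mono) auto
  then show ?thesis
    by (rule order_trans[OF z_le[OF t]])
qed

text \<open>The form used for trajectories: \<open>y\<close> is an integral of \<open>F\<close>, and \<open>F\<close> grows at most affinely in \<open>y\<close>.
  It yields both the a priori bound on trajectories and their dependence on the control.\<close>

lemma gronwall_has_integral:
  fixes y :: "real \<Rightarrow> 'a::euclidean_space"
  assumes "0 < C" "0 \<le> A" "0 \<le> T" and y: "continuous_on {0..T} y"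
    and int: "\<And>t. t \<in> {0..T} \<Longrightarrow> (F has_integral (y t - y 0)) {0..t}"
    and F: "\<And>t. t \<in> {0..T} \<Longrightarrow> norm (F t) \<le> C * norm (y t) + A"
    and t: "t \<in> {0..T}"
  shows "norm (y t) \<le> 2 * (norm (y 0) + A * T) * exp (2 * C * T)"
proof -
  have "norm (y t) \<le> 2 * (norm (y 0) + A * T) * exp (2 * C * t)"
  proof (rule gronwall_integral[OF \<open>0 < C\<close> _ \<open>0 \<le> T\<close> _ _ t])
    show "0 \<le> norm (y 0) + A * T"
      using assms by simp
    show "continuous_on {0..T} (\<lambda>t. norm (y t))"
      by (intro continuous_intros y)
    fix s assume s: "s \<in> {0..T}"
    have ny: "(\<lambda>r. norm (y r)) integrable_on {0..s}"
      using s by (intro integrable_continuous_real continuous_intros continuous_on_subset[OF y]) auto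
    have "norm (integral {0..s} F) \<le> integral {0..s} (\<lambda>r. C * norm (y r) + A)"
      using int[OF s] F s ny
      by (intro Henstock_Kurzweil_Integration.integral_norm_bound_integral integrable_add integrable_on_mult_right)
        (auto intro: has_integral_integrable)
    also have "\<dots> = C * integral {0..s} (\<lambda>r. norm (y r)) + A * s"
      using ny s by (subst integral_add) (auto intro: integrable_on_mult_right)
    also have "\<dots> \<le> C * integral {0..s} (\<lambda>r. norm (y r)) + A * T"
      using s \<open>0 \<le> A\<close> by (simp add: mult_left_mono)
    finally have "norm (y s - y 0) \<le> C * integral {0..s} (\<lambda>r. norm (y r)) + A * T"
      using integral_unique[OF int[OF s]] by simp
    then show "norm (y s) \<le> norm (y 0) + A * T + C * integral {0..s} (\<lambda>r. norm (y r))"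
      using norm_triangle_ineq[of "y s - y 0" "y 0"] by simp
  qed
  also have "\<dots> \<le> 2 * (norm (y 0) + A * T) * exp (2 * C * T)"
    using assms by (intro mult_left_mono) auto
  finally show ?thesis .
qed

lemma bcontfun_clamp:
  fixes h :: "real \<Rightarrow> 'a::euclidean_space"
  assumes "0 \<le> T" "continuous_on {0..T} h"
  shows "(\<lambda>t. h (max 0 (min T t))) \<in> bcontfun"
proof -
  have "range (\<lambda>t. h (max 0 (min T t))) \<subseteq> h ` {0..T}"
    using \<open>0 \<le> T\<close> by auto
  moreover have "bounded (h ` {0..T})"
    using assms(2) by (intro compact_imp_bounded compact_continuous_image) auto
  ultimately have "bounded (range (\<lambda>t. h (max 0 (min T t))))"
    by (rule bounded_subset[rotated])
  moreover have "continuous_on UNIV (\<lambda>t. h (max 0 (min T t)))"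
    using \<open>0 \<le> T\<close> by (intro continuous_on_compose2[OF assms(2)] continuous_intros) auto
  ultimately show ?thesis
    by (simp add: bcontfun_def)
qed

text \<open>The Caratheodory existence theorem for a globally Lipschitz field, by Banach's fixed point
  theorem. The unknown is \<open>v(t) = exp(-2Ct) y(t)\<close> instead of \<open>y\<close>: with this weight the Picard
  operator contracts by the factor one half on the whole interval, however long it is. Curves on
  \<open>{0..T}\<close> are extended to bounded continuous functions on the line by constants.\<close>

lemma integral_equation_solution_exists:
  fixes g :: "real \<Rightarrow> 'a::euclidean_space \<Rightarrow> 'a"
  assumes T: "0 \<le> T" and C: "0 < C"
    and lip: "\<And>t y z. t \<in> {0..T} \<Longrightarrow> norm (g t y - g t z) \<le> C * norm (y - z)"
    and int: "\<And>y. continuous_on {0..T} y \<Longrightarrow> (\<lambda>t. g t (y t)) integrable_on {0..T}"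
  obtains y where "continuous_on {0..T} y"
    "\<And>t. t \<in> {0..T} \<Longrightarrow> y t = x0 + integral {0..t} (\<lambda>s. g s (y s))"
proof -
  define G where "G v s = g s (exp (2 * C * s) *\<^sub>R apply_bcontfun v s)" for v s
  define h where "h v t = exp (- (2 * C * t)) *\<^sub>R (x0 + integral {0..t} (G v))" for v t
  define \<kappa> where "\<kappa> t = max 0 (min T t)" for t :: real
  have \<kappa>: "\<kappa> t \<in> {0..T}" for t
    using T by (auto simp: \<kappa>_def)
  have G_int: "G v integrable_on {0..T}" for v
    unfolding G_def by (intro int continuous_intros continuous_on_apply_bcontfun)
  have h_cont: "continuous_on {0..T} (h v)" for v
    unfolding h_def by (intro continuous_intros indefinite_integral_continuous_1 G_int)
  define \<Phi> where "\<Phi> v = Bcontfun (\<lambda>t. h v (\<kappa> t))" for v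
  have \<Phi>: "apply_bcontfun (\<Phi> v) t = h v (\<kappa> t)" for v t
    unfolding \<Phi>_def \<kappa>_def using bcontfun_clamp[OF T h_cont] by (simp add: Bcontfun_inverse)
  have "dist (\<Phi> v) (\<Phi> w) \<le> 1/2 * dist v w" for v w
  proof (rule dist_bound)
    fix t
    define r where "r = \<kappa> t"
    have r: "0 \<le> r" "r \<le> T"
      using \<kappa>[of t] by (auto simp: r_def)
    have Gr: "G v integrable_on {0..r}" for v
      using integrable_on_subinterval[OF G_int[of v], of 0 r] r by auto
    have E_int: "((\<lambda>s. dist v w / 2 * exp (2 * C * s) * (2 * C)) has_integral
        dist v w / 2 * exp (2 * C * r) - dist v w / 2 * exp (2 * C * 0)) {0..r}"
      using r by (intro fundamental_theorem_of_calculus)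
        (auto simp: has_real_derivative_iff_has_vector_derivative[symmetric] intro!: derivative_eq_intros)
    have "norm (integral {0..r} (G v) - integral {0..r} (G w)) = norm (integral {0..r} (\<lambda>s. G v s - G w s))"
      using Gr by (simp add: Henstock_Kurzweil_Integration.integral_diff)
    also have "\<dots> \<le> integral {0..r} (\<lambda>s. dist v w / 2 * exp (2 * C * s) * (2 * C))"
    proof (rule Henstock_Kurzweil_Integration.integral_norm_bound_integral)
      show "(\<lambda>s. G v s - G w s) integrable_on {0..r}"
        by (intro Henstock_Kurzweil_Integration.integrable_diff Gr)
      show "(\<lambda>s. dist v w / 2 * exp (2 * C * s) * (2 * C)) integrable_on {0..r}"
        using E_int by (rule has_integral_integrable)
      fix s assume s: "s \<in> {0..r}"
      have "norm (G v s - G w s) \<le> C * norm (exp (2 * C * s) *\<^sub>R v s - exp (2 * C * s) *\<^sub>R w s)"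
        unfolding G_def using s r by (intro lip) auto
      also have "\<dots> = C * exp (2 * C * s) * dist (v s) (w s)"
        by (simp add: dist_norm flip: scaleR_diff_right)
      also have "\<dots> \<le> C * exp (2 * C * s) * dist v w"
        using C by (intro mult_left_mono dist_bounded) auto
      finally show "norm (G v s - G w s) \<le> dist v w / 2 * exp (2 * C * s) * (2 * C)"
        by (simp add: algebra_simps)
    qed
    also have "\<dots> \<le> dist v w / 2 * exp (2 * C * r)"
      unfolding integral_unique[OF E_int] by simp
    finally have "norm (integral {0..r} (G v) - integral {0..r} (G w)) \<le> dist v w / 2 * exp (2 * C * r)" .
    moreover have "dist (\<Phi> v t) (\<Phi> w t) =
        exp (- (2 * C * r)) * norm (integral {0..r} (G v) - integral {0..r} (G w))"
      unfolding \<Phi> h_def r_def[symmetric] by (simp add: dist_norm flip: scaleR_diff_right)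
    ultimately have "dist (\<Phi> v t) (\<Phi> w t) \<le> exp (- (2 * C * r)) * (dist v w / 2 * exp (2 * C * r))"
      by (simp add: mult_left_mono)
    also have "\<dots> = 1/2 * dist v w"
      by (simp add: exp_minus)
    finally show "dist (\<Phi> v t) (\<Phi> w t) \<le> 1/2 * dist v w" .
  qed
  then obtain v where v: "\<Phi> v = v"
    using banach_fix_type[of "1/2" \<Phi>] by auto
  show thesis
  proof (rule that)
    show "continuous_on {0..T} (\<lambda>t. exp (2 * C * t) *\<^sub>R apply_bcontfun v t)"
      by (intro continuous_intros continuous_on_apply_bcontfun)
    fix t assume t: "t \<in> {0..T}"
    then have "apply_bcontfun v t = h v t"
      using \<Phi>[of v t] v by (simp add: \<kappa>_def)
    then show "exp (2 * C * t) *\<^sub>R apply_bcontfun v t =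
        x0 + integral {0..t} (\<lambda>s. g s (exp (2 * C * s) *\<^sub>R apply_bcontfun v s))"
      by (simp add: h_def exp_minus G_def[abs_def])
  qed
qed

section \<open>Integration against relaxed controls\<close>

lemma nn_integral_mix_measure:
  assumes s: "sets N = sets M" and f: "f \<in> borel_measurable M"
  shows "(\<integral>\<^sup>+u. f u \<partial>mix_measure l N M) =
    ennreal l * (\<integral>\<^sup>+u. f u \<partial>N) + ennreal (1 - l) * (\<integral>\<^sup>+u. f u \<partial>M)"
  using f
proof induction
  case (cong f g)
  have "(\<integral>\<^sup>+u. f u \<partial>K) = (\<integral>\<^sup>+u. g u \<partial>K)" if "space K = space M" for K
    using cong that by (intro nn_integral_cong) auto
  then show ?case
    using cong sets_eq_imp_space_eq[OF s] by simp
next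
  case (set A)
  then show ?case
    using s by (simp add: emeasure_mix_measure)
next
  case (mult f c)
  have "f \<in> borel_measurable N" "f \<in> borel_measurable (mix_measure l N M)"
    using mult s by (simp_all add: measurable_def sets_eq_imp_space_eq[OF s])
  then show ?case
    using mult by (simp add: nn_integral_cmult algebra_simps)
next
  case (add f g)
  have "f \<in> borel_measurable N" "f \<in> borel_measurable (mix_measure l N M)"
    "g \<in> borel_measurable N" "g \<in> borel_measurable (mix_measure l N M)"
    using add s by (simp_all add: measurable_def sets_eq_imp_space_eq[OF s])
  then show ?case
    using add by (simp add: nn_integral_add algebra_simps)
next
  case (seq F)
  have m: "\<And>i. F i \<in> borel_measurable N" "\<And>i. F i \<in> borel_measurable (mix_measure l N M)"
    using seq s by (simp_all add: measurable_def sets_eq_imp_space_eq[OF s])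
  have inc: "incseq (\<lambda>i. integral\<^sup>N N (F i))" "incseq (\<lambda>i. integral\<^sup>N M (F i))"
    using \<open>incseq F\<close> by (auto simp: incseq_def le_fun_def intro!: nn_integral_mono)
  have "(\<integral>\<^sup>+u. (SUP i. F i) u \<partial>K) = (SUP i. integral\<^sup>N K (F i))"
    if "\<And>i. F i \<in> borel_measurable K" for K
    using nn_integral_monotone_convergence_SUP[OF \<open>incseq F\<close> that] by (simp add: image_comp)
  moreover have "ennreal l * (SUP i. integral\<^sup>N N (F i)) + ennreal (1 - l) * (SUP i. integral\<^sup>N M (F i)) =
      (SUP i. ennreal l * integral\<^sup>N N (F i) + ennreal (1 - l) * integral\<^sup>N M (F i))"
    using inc by (subst ennreal_SUP_add) (auto simp: SUP_mult_left_ennreal incseq_def intro!: mult_left_mono)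
  moreover have "integral\<^sup>N (mix_measure l N M) (F i) =
      ennreal l * integral\<^sup>N N (F i) + ennreal (1 - l) * integral\<^sup>N M (F i)" for i
    by (rule seq)
  ultimately show ?case
    using m seq.hyps(1) by (simp only: SUP_apply)
qed

lemma integral_mix_measure:
  fixes f :: "'u \<Rightarrow> 'b::euclidean_space"
  assumes s: "sets N = sets M" and l: "0 \<le> l" "l \<le> 1"
    and f: "integrable N f" "integrable M f"
  shows "(\<integral>u. f u \<partial>mix_measure l N M) = l *\<^sub>R (\<integral>u. f u \<partial>N) + (1 - l) *\<^sub>R (\<integral>u. f u \<partial>M)"
proof -
  have int: "integrable (mix_measure l N M) g" if "integrable N g" "integrable M g"
    for g :: "'u \<Rightarrow> 'c::euclidean_space"
  proof (rule integrableI_bounded)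
    show "g \<in> borel_measurable (mix_measure l N M)"
      using borel_measurable_integrable[OF that(2)] by (simp add: measurable_def)
    have "(\<integral>\<^sup>+u. ennreal (norm (g u)) \<partial>mix_measure l N M) =
        ennreal l * (\<integral>\<^sup>+u. ennreal (norm (g u)) \<partial>N) + ennreal (1 - l) * (\<integral>\<^sup>+u. ennreal (norm (g u)) \<partial>M)"
      using that by (intro nn_integral_mix_measure[OF s]) auto
    also have "\<dots> < \<infinity>"
      using that by (auto simp: integrable_iff_bounded ennreal_mult_less_top)
    finally show "(\<integral>\<^sup>+u. ennreal (norm (g u)) \<partial>mix_measure l N M) < \<infinity>" .
  qed
  have real: "(\<integral>u. g u \<partial>mix_measure l N M) = l * (\<integral>u. g u \<partial>N) + (1 - l) * (\<integral>u. g u \<partial>M)"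
    if g: "integrable N g" "integrable M g" for g :: "'u \<Rightarrow> real"
  proof -
    have "enn2real (\<integral>\<^sup>+u. ennreal (h u) \<partial>mix_measure l N M) =
        l * enn2real (\<integral>\<^sup>+u. ennreal (h u) \<partial>N) + (1 - l) * enn2real (\<integral>\<^sup>+u. ennreal (h u) \<partial>M)"
      if h: "integrable N h" "integrable M h" for h :: "'u \<Rightarrow> real"
    proof -
      have "(\<integral>\<^sup>+u. ennreal (h u) \<partial>N) < top" "(\<integral>\<^sup>+u. ennreal (h u) \<partial>M) < top"
        using h by (simp_all add: real_integrable_def less_top)
      moreover have "(\<integral>\<^sup>+u. ennreal (h u) \<partial>mix_measure l N M) =
          ennreal l * (\<integral>\<^sup>+u. ennreal (h u) \<partial>N) + ennreal (1 - l) * (\<integral>\<^sup>+u. ennreal (h u) \<partial>M)"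
        using h by (intro nn_integral_mix_measure[OF s]) auto
      ultimately show ?thesis
        using l by (simp add: enn2real_plus ennreal_mult_less_top enn2real_mult)
    qed
    from this[of g] this[of "\<lambda>u. - g u"] show ?thesis
      using g int[OF g] by (simp add: real_lebesgue_integral_def algebra_simps)
  qed
  show "(\<integral>u. f u \<partial>mix_measure l N M) = l *\<^sub>R (\<integral>u. f u \<partial>N) + (1 - l) *\<^sub>R (\<integral>u. f u \<partial>M)"
  proof (rule euclidean_eqI)
    fix b :: 'b assume "b \<in> Basis"
    show "(\<integral>u. f u \<partial>mix_measure l N M) \<bullet> b = (l *\<^sub>R (\<integral>u. f u \<partial>N) + (1 - l) *\<^sub>R (\<integral>u. f u \<partial>M)) \<bullet> b"
      using real[of "\<lambda>u. f u \<bullet> b"] f int[OF f] by (simp add: inner_add_left)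
  qed
qed

lemma compact_continuous_norm_bound_Times:
  fixes \<phi> :: "'t::metric_space \<Rightarrow> 'u::metric_space \<Rightarrow> 'b::real_normed_vector"
  assumes "compact S" "compact U" "continuous_on (S \<times> U) (\<lambda>(t, u). \<phi> t u)"
  obtains B where "\<And>t u. t \<in> S \<Longrightarrow> u \<in> U \<Longrightarrow> norm (\<phi> t u) \<le> B"
proof -
  obtain B where B: "\<And>z. z \<in> S \<times> U \<Longrightarrow> norm ((\<lambda>(t, u). \<phi> t u) z) \<le> B"
    using compact_continuous_norm_bound[OF compact_Times[OF assms(1,2)] assms(3)] by metis
  show thesis
  proof (rule that)
    fix t u assume "t \<in> S" "u \<in> U"
    then show "norm (\<phi> t u) \<le> B"
      using B[of "(t, u)"] by simp
  qed
qed

lemma measurable_prob_measures_on: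
  fixes \<phi> :: "'u::topological_space \<Rightarrow> 'b::topological_space"
  assumes "m \<in> prob_measures_on U" "continuous_on U \<phi>"
  shows "\<phi> \<in> borel_measurable m"
  using borel_measurable_continuous_on_restrict[OF assms(2)] assms(1)
  by (simp add: prob_measures_on_def cong: measurable_cong_sets)

lemma integrable_prob_measures_on:
  fixes \<phi> :: "'u::metric_space \<Rightarrow> 'b::{banach, second_countable_topology}"
  assumes "compact U" "m \<in> prob_measures_on U" "continuous_on U \<phi>"
  shows "integrable m \<phi>"
proof -
  interpret prob_space m
    using assms(2) by (simp add: prob_measures_on_def)
  obtain B where "\<And>z. z \<in> U \<Longrightarrow> norm (\<phi> z) \<le> B"
    using compact_continuous_norm_bound[OF assms(1,3)] by blast
  then show ?thesis
    using assms by (intro integrable_const_bound[of _ B] measurable_prob_measures_on[OF assms(2,3)])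
      (auto simp: prob_measures_on_def)
qed

lemma norm_integral_prob_measures_on_le:
  fixes \<phi> :: "'u::topological_space \<Rightarrow> 'b::{banach, second_countable_topology}"
  assumes m: "m \<in> prob_measures_on U" and B: "\<And>u. u \<in> U \<Longrightarrow> norm (\<phi> u) \<le> B"
  shows "norm (\<integral>u. \<phi> u \<partial>m) \<le> B"
proof (cases "integrable m \<phi>")
  case True
  interpret prob_space m
    using m by (simp add: prob_measures_on_def)
  have "norm (\<integral>u. \<phi> u \<partial>m) \<le> (\<integral>u. norm (\<phi> u) \<partial>m)"
    by (rule integral_norm_bound)
  also have "\<dots> \<le> (\<integral>u. B \<partial>m)"
    using True m B by (intro integral_mono) (auto simp: prob_measures_on_def)
  finally show ?thesis by (simp add: prob_space)
next
  \<comment> \<open>The integral is then zero by convention, and the bound is nonnegative because \<open>U\<close> is nonempty.\<close>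
  case False
  interpret prob_space m
    using m by (simp add: prob_measures_on_def)
  obtain u where "u \<in> U"
    using not_empty m by (auto simp: prob_measures_on_def)
  then have "0 \<le> B"
    using B norm_ge_zero order_trans by blast
  then show ?thesis
    using False by (simp add: not_integrable_integral_eq)
qed

lemma relaxed_controlD:
  assumes "relaxed_control U tf \<mu>" "t \<in> {0..tf}"
  shows "\<mu> t \<in> prob_measures_on U"
  using assms by (simp add: relaxed_control_def)

lemma continuous_on_slice:
  assumes "continuous_on (S \<times> U) (\<lambda>(t, u). \<phi> t u)" "t \<in> S"
  shows "continuous_on U (\<phi> t)"
proof -
  have "continuous_on U ((\<lambda>(t, u). \<phi> t u) \<circ> (\<lambda>u. (t, u)))"
    using assms by (intro continuous_on_compose continuous_intros) (auto intro: continuous_on_subset)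
  then show ?thesis by (simp add: o_def)
qed

text \<open>Measurability of a relaxed control only concerns integrands that do not depend on time. A
  time-dependent integrand is frozen at the last grid point of mesh \<open>1/(n+1)\<close>: the resulting
  integrals are measurable, being glued from countably many measurable functions, and they converge
  by dominated convergence.\<close>

lemma measurable_relaxed_integral_real:
  fixes \<phi> :: "real \<Rightarrow> 'u::metric_space \<Rightarrow> real"
  assumes \<mu>: "relaxed_control U tf \<mu>" and "compact U" "0 \<le> tf"
    and cont: "continuous_on ({0..tf} \<times> U) (\<lambda>(t, u). \<phi> t u)"
  shows "(\<lambda>t. \<integral>u. \<phi> t u \<partial>\<mu> t) \<in> borel_measurable (lebesgue_on {0..tf})"
proof -
  \<comment> \<open>\<open>c n i\<close> is the \<open>i\<close>-th grid point, clamped so that it stays in the time interval.\<close>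
  define c where "c n i = max 0 (min tf (of_int i / real (Suc n)))" for n :: nat and i :: int
  have c: "c n i \<in> {0..tf}" for n i
    using \<open>0 \<le> tf\<close> by (auto simp: c_def)
  define s where "s n t = c n \<lfloor>real (Suc n) * t\<rfloor>" for n and t :: real
  have s: "s n t \<in> {0..tf}" for n t
    using c by (simp add: s_def)
  have s_lim: "(\<lambda>n. s n t) \<longlonglongrightarrow> t" if t: "t \<in> {0..tf}" for t
  proof (rule LIM_zero_cancel, rule Lim_null_comparison[OF _ LIMSEQ_inverse_real_of_nat])
    have "\<bar>s n t - t\<bar> \<le> inverse (real (Suc n))" for n
    proof -
      have "of_int \<lfloor>real (Suc n) * t\<rfloor> / real (Suc n) \<le> t"
        by (simp add: field_simps)
      moreover have "real (Suc n) * t \<le> of_int \<lfloor>real (Suc n) * t\<rfloor> + 1"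
        by linarith
      then have "t \<le> of_int \<lfloor>real (Suc n) * t\<rfloor> / real (Suc n) + inverse (real (Suc n))"
        by (simp add: field_simps)
      ultimately show ?thesis
        using t unfolding s_def c_def by auto
    qed
    then show "\<forall>\<^sub>F n in sequentially. norm (s n t - t) \<le> inverse (real (Suc n))"
      by simp
  qed
  obtain B where B: "\<And>t u. t \<in> {0..tf} \<Longrightarrow> u \<in> U \<Longrightarrow> norm (\<phi> t u) \<le> B"
    using compact_continuous_norm_bound_Times[OF compact_Icc \<open>compact U\<close> cont] by metis
  show ?thesis
  proof (rule borel_measurable_LIMSEQ_metric)
    fix n
    have "(\<lambda>t. \<integral>u. \<phi> (c n i) u \<partial>\<mu> t) \<in> borel_measurable (lebesgue_on {0..tf})" for i
      using \<mu> continuous_on_slice[OF cont c] by (auto simp: relaxed_control_def)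
    moreover have "(\<lambda>t. \<lfloor>real (Suc n) * t\<rfloor>) \<in> measurable (lebesgue_on {0..tf}) (count_space UNIV)"
      by (intro measurable_restrict_space1 measurable_completion) measurable
    ultimately show "(\<lambda>t. \<integral>u. \<phi> (s n t) u \<partial>\<mu> t) \<in> borel_measurable (lebesgue_on {0..tf})"
      unfolding s_def by (rule measurable_compose_countable)
  next
    fix t assume "t \<in> space (lebesgue_on {0..tf})"
    then have t: "t \<in> {0..tf}" by simp
    interpret prob_space "\<mu> t"
      using relaxed_controlD[OF \<mu> t] by (simp add: prob_measures_on_def)
    have space: "space (\<mu> t) = U"
      using relaxed_controlD[OF \<mu> t] by (simp add: prob_measures_on_def)
    show "(\<lambda>n. \<integral>u. \<phi> (s n t) u \<partial>\<mu> t) \<longlonglongrightarrow> (\<integral>u. \<phi> t u \<partial>\<mu> t)"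
    proof (rule integral_dominated_convergence[where w = "\<lambda>_. B"])
      show "AE u in \<mu> t. (\<lambda>n. \<phi> (s n t) u) \<longlonglongrightarrow> \<phi> t u"
      proof (rule AE_I2)
        fix u assume "u \<in> space (\<mu> t)"
        then have "(\<lambda>n. (\<lambda>(t, u). \<phi> t u) (s n t, u)) \<longlonglongrightarrow> (\<lambda>(t, u). \<phi> t u) (t, u)"
          using t s space
          by (intro continuous_on_tendsto_compose[OF cont] tendsto_Pair s_lim tendsto_const) auto
        then show "(\<lambda>n. \<phi> (s n t) u) \<longlonglongrightarrow> \<phi> t u" by simp
      qed
      show "AE u in \<mu> t. norm (\<phi> (s n t) u) \<le> B" for n
        using B[OF s] space by (intro AE_I2) auto
    qed (auto intro!: measurable_prob_measures_on[OF relaxed_controlD[OF \<mu> t]] continuous_on_slice[OF cont] t s)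
  qed
qed

lemma measurable_relaxed_integral:
  fixes \<phi> :: "real \<Rightarrow> 'u::metric_space \<Rightarrow> 'b::euclidean_space"
  assumes \<mu>: "relaxed_control U tf \<mu>" and "compact U" "0 \<le> tf"
    and cont: "continuous_on ({0..tf} \<times> U) (\<lambda>(t, u). \<phi> t u)"
  shows "(\<lambda>t. \<integral>u. \<phi> t u \<partial>\<mu> t) \<in> borel_measurable (lebesgue_on {0..tf})"
proof (subst borel_measurable_euclidean_space, intro ballI)
  fix b :: 'b assume "b \<in> Basis"
  have "(\<lambda>t. \<integral>u. \<phi> t u \<bullet> b \<partial>\<mu> t) \<in> borel_measurable (lebesgue_on {0..tf})"
    using cont by (intro measurable_relaxed_integral_real[OF assms(1-3)])
      (auto simp: case_prod_unfold intro!: continuous_intros)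
  moreover have eq: "(\<integral>u. \<phi> t u \<bullet> b \<partial>\<mu> t) = (\<integral>u. \<phi> t u \<partial>\<mu> t) \<bullet> b" if "t \<in> {0..tf}" for t
    using integrable_prob_measures_on[OF \<open>compact U\<close> relaxed_controlD[OF \<mu> that] continuous_on_slice[OF cont that]]
    by simp
  ultimately show "(\<lambda>t. (\<integral>u. \<phi> t u \<partial>\<mu> t) \<bullet> b) \<in> borel_measurable (lebesgue_on {0..tf})"
    using measurable_cong[of "lebesgue_on {0..tf}" "\<lambda>t. \<integral>u. \<phi> t u \<bullet> b \<partial>\<mu> t" "\<lambda>t. (\<integral>u. \<phi> t u \<partial>\<mu> t) \<bullet> b" borel]
    by simp
qed

lemma relaxed_integral_integrable:
  fixes \<phi> :: "real \<Rightarrow> 'u::metric_space \<Rightarrow> 'b::euclidean_space"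
  assumes \<mu>: "relaxed_control U tf \<mu>" and "compact U" "0 \<le> tf"
    and cont: "continuous_on ({0..tf} \<times> U) (\<lambda>(t, u). \<phi> t u)"
  shows "integrable (lebesgue_on {0..tf}) (\<lambda>t. \<integral>u. \<phi> t u \<partial>\<mu> t)"
proof -
  obtain B where B: "\<And>t u. t \<in> {0..tf} \<Longrightarrow> u \<in> U \<Longrightarrow> norm (\<phi> t u) \<le> B"
    using compact_continuous_norm_bound_Times[OF compact_Icc \<open>compact U\<close> cont] by metis
  show ?thesis
  proof (rule finite_measure.integrable_const_bound[of _ _ B])
    show "finite_measure (lebesgue_on {0..tf})"
      by (rule finite_measure_lebesgue_on) simp
    show "AE t in lebesgue_on {0..tf}. norm (\<integral>u. \<phi> t u \<partial>\<mu> t) \<le> B"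
      using norm_integral_prob_measures_on_le[OF relaxed_controlD[OF \<mu>] B] by (intro AE_I2) auto
  qed (rule measurable_relaxed_integral[OF assms])
qed

lemma relaxed_control_mix:
  fixes \<mu> \<nu> :: "real \<Rightarrow> 'u::metric_space measure"
  assumes \<mu>: "relaxed_control U tf \<mu>" and \<nu>: "relaxed_control U tf \<nu>" and "compact U"
    and l: "0 \<le> l" "l \<le> 1"
  shows "relaxed_control U tf (mix_control l \<nu> \<mu>)"
  unfolding relaxed_control_def
proof (intro conjI ballI allI impI)
  fix t assume "t \<in> {0..tf}"
  then show "mix_control l \<nu> \<mu> t \<in> prob_measures_on U"
    using \<mu> \<nu> l by (auto simp: mix_control_def relaxed_control_def intro!: mix_measure_prob_measures_on)
next
  fix \<phi> :: "'u \<Rightarrow> real" assume \<phi>: "continuous_on U \<phi>"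
  have "(\<lambda>t. l *\<^sub>R (\<integral>u. \<phi> u \<partial>\<nu> t) + (1 - l) *\<^sub>R (\<integral>u. \<phi> u \<partial>\<mu> t)) \<in> borel_measurable (lebesgue_on {0..tf})"
    using \<mu> \<nu> \<phi> unfolding relaxed_control_def
    by (intro borel_measurable_add borel_measurable_scaleR borel_measurable_const) blast+
  moreover have "(\<integral>u. \<phi> u \<partial>mix_control l \<nu> \<mu> t) = l *\<^sub>R (\<integral>u. \<phi> u \<partial>\<nu> t) + (1 - l) *\<^sub>R (\<integral>u. \<phi> u \<partial>\<mu> t)"
    if "t \<in> {0..tf}" for t
    using relaxed_controlD[OF \<mu> that] relaxed_controlD[OF \<nu> that] unfolding mix_control_def
    by (intro integral_mix_measure l integrable_prob_measures_on[OF \<open>compact U\<close> _ \<phi>])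
      (auto simp: prob_measures_on_def)
  ultimately show "(\<lambda>t. \<integral>u. \<phi> u \<partial>mix_control l \<nu> \<mu> t) \<in> borel_measurable (lebesgue_on {0..tf})"
    using measurable_cong[of "lebesgue_on {0..tf}" "\<lambda>t. \<integral>u. \<phi> u \<partial>mix_control l \<nu> \<mu> t"
      "\<lambda>t. l *\<^sub>R (\<integral>u. \<phi> u \<partial>\<nu> t) + (1 - l) *\<^sub>R (\<integral>u. \<phi> u \<partial>\<mu> t)" borel]
    by simp
qed

section \<open>Lipschitz and Taylor estimates that are uniform in the control\<close>

lemma locally_lipschitz_on_imp_continuous_on:
  assumes "locally_lipschitz_on S g"
  shows "continuous_on S g"
  unfolding continuous_on_eq_continuous_within
proof
  fix z assume "z \<in> S"
  then obtain r C where r: "r > 0" and C: "C-lipschitz_on (S \<inter> ball z r) g"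
    using assms by (auto simp: locally_lipschitz_on_def)
  have "continuous (at z within (S \<inter> ball z r)) g"
    using lipschitz_on_continuous_on[OF C] \<open>z \<in> S\<close> r by (simp add: continuous_on_eq_continuous_within)
  then show "continuous (at z within S) g"
    using at_within_nhd[of z "ball z r" "S \<inter> ball z r" S] r by (simp add: continuous_within Int_assoc)
qed

lemma lipschitz_uniform_on_compact:
  fixes \<phi> :: "'a::metric_space \<Rightarrow> 'u::metric_space \<Rightarrow> 'b::metric_space"
  assumes loc: "locally_lipschitz_on (UNIV \<times> U) (\<lambda>(x, u). \<phi> x u)" and "compact U" "compact S"
  obtains C where "0 < C" "\<And>u x y. u \<in> U \<Longrightarrow> x \<in> S \<Longrightarrow> y \<in> S \<Longrightarrow> dist (\<phi> x u) (\<phi> y u) \<le> C * dist x y"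
proof -
  have "local_lipschitz U UNIV (\<lambda>u x. \<phi> x u)"
    unfolding local_lipschitz_def
  proof (intro ballI)
    fix x :: 'a and u assume "u \<in> U"
    then obtain r C where r: "r > 0" and C: "C-lipschitz_on ((UNIV \<times> U) \<inter> ball (x, u) r) (\<lambda>(x, u). \<phi> x u)"
      using loc by (force simp: locally_lipschitz_on_def)
    have mem: "(y, u') \<in> (UNIV \<times> U) \<inter> ball (x, u) r" if "y \<in> cball x (r / 3)" "u' \<in> cball u (r / 3) \<inter> U" for y u'
    proof -
      have "dist (x, u) (y, u') \<le> dist x y + dist u u'"
        by (simp add: dist_Pair_Pair sqrt_sum_squares_le_sum)
      then show ?thesis using that r by auto
    qed
    have "C-lipschitz_on (cball x (r / 3) \<inter> UNIV) (\<lambda>x. \<phi> x u')" if u': "u' \<in> cball u (r / 3) \<inter> U" for u'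
    proof (rule lipschitz_onI)
      fix y z assume "y \<in> cball x (r / 3) \<inter> UNIV" "z \<in> cball x (r / 3) \<inter> UNIV"
      then show "dist (\<phi> y u') (\<phi> z u') \<le> C * dist y z"
        using lipschitz_onD[OF C mem[OF _ u'] mem[OF _ u'], of y z] by (simp add: dist_Pair_Pair)
    qed (rule lipschitz_on_nonneg[OF C])
    then show "\<exists>e>0. \<exists>C. \<forall>u'\<in>cball u e \<inter> U. C-lipschitz_on (cball x e \<inter> UNIV) (\<lambda>x. \<phi> x u')"
      using r by (intro exI[of _ "r / 3"] conjI exI[of _ C]) auto
  qed
  then have loc': "local_lipschitz U S (\<lambda>u x. \<phi> x u)"
    by (rule local_lipschitz_subset) auto
  have cont: "continuous_on U (\<lambda>u. \<phi> x u)" for x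
    by (rule continuous_on_slice[OF locally_lipschitz_on_imp_continuous_on[OF loc]]) simp
  obtain C where C: "\<And>u. u \<in> U \<Longrightarrow> C-lipschitz_on S (\<lambda>x. \<phi> x u)"
    using local_lipschitz_compact_implies_lipschitz[OF loc' \<open>compact S\<close> \<open>compact U\<close> cont] by blast
  show thesis
  proof (rule that[of "\<bar>C\<bar> + 1"])
    fix u x y assume "u \<in> U" "x \<in> S" "y \<in> S"
    then have "dist (\<phi> x u) (\<phi> y u) \<le> C * dist x y"
      using C lipschitz_onD by fast
    also have "\<dots> \<le> (\<bar>C\<bar> + 1) * dist x y"
      by (intro mult_right_mono) auto
    finally show "dist (\<phi> x u) (\<phi> y u) \<le> (\<bar>C\<bar> + 1) * dist x y" .
  qed simp
qed

lemma taylor_remainder_le: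
  fixes f :: "'a::real_normed_vector \<Rightarrow> 'b::real_normed_vector"
  assumes f: "\<And>z. (f has_derivative f' z) (at z)"
    and lip: "\<And>z h. z \<in> closed_segment x y \<Longrightarrow> norm (f' z h - f' x h) \<le> C * norm (z - x) * norm h"
    and C: "0 \<le> C"
  shows "norm (f y - f x - f' x (y - x)) \<le> C * (norm (y - x))\<^sup>2"
proof -
  have "norm (f y - f x - f' x (y - x)) \<le> norm (y - x) * (C * norm (y - x))"
  proof (rule differentiable_bound_linearization[where S = "closed_segment x y"])
    show "x + t *\<^sub>R (y - x) \<in> closed_segment x y" if "t \<in> {0..1}" for t
      using that by (auto simp: in_segment algebra_simps intro!: exI[of _ t])
    show "(f has_derivative f' z) (at z within closed_segment x y)" for z
      using f by (rule has_derivative_at_withinI)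
    fix z assume z: "z \<in> closed_segment x y"
    show "onorm (f' z - f' x) \<le> C * norm (y - x)"
    proof (rule onorm_bound)
      fix h
      have "norm (f' z h - f' x h) \<le> C * norm (z - x) * norm h"
        by (rule lip[OF z])
      also have "\<dots> \<le> C * norm (y - x) * norm h"
        using segment_bound(1)[OF z] C by (intro mult_right_mono mult_left_mono) (auto simp: norm_minus_commute)
      finally show "norm ((f' z - f' x) h) \<le> C * norm (y - x) * norm h" by simp
    qed (use C in simp)
  qed simp
  then show ?thesis
    by (simp add: power2_eq_square algebra_simps)
qed

lemma norm_matrix_vector_mult_le:
  fixes A :: "real^'n^'m"
  shows "norm (A *v h) \<le> norm A * norm h"
proof -
  have "norm (A *v h) \<le> L2_set (\<lambda>i. norm (A $ i) * norm h) UNIV"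
    unfolding norm_vec_def[of "A *v h"]
    by (rule L2_set_mono) (auto simp: matrix_vector_mul_component intro: order_trans[OF Cauchy_Schwarz_ineq2])
  also have "\<dots> = norm A * norm h"
    by (simp add: norm_vec_def[of A] L2_set_left_distrib)
  finally show ?thesis .
qed

lemma has_derivative_gradx:
  assumes "(\<lambda>y. L y u) differentiable (at x)"
  shows "((\<lambda>y. L y u) has_derivative (\<lambda>h. gradx L x u \<bullet> h)) (at x)"
proof -
  let ?D = "frechet_derivative (\<lambda>y. L y u) (at x)"
  have D: "((\<lambda>y. L y u) has_derivative ?D) (at x)"
    using assms frechet_derivative_works by blast
  then interpret D: linear ?D
    by (rule has_derivative_linear)
  have "?D h = gradx L x u \<bullet> h" for h
  proof -
    have "?D h = ?D (\<Sum>i\<in>UNIV. h $ i *\<^sub>R axis i 1)"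
      using basis_expansion[of h] by (simp add: scalar_mult_eq_scaleR)
    also have "\<dots> = (\<Sum>i\<in>UNIV. h $ i * ?D (axis i 1))"
      by (simp add: D.sum D.scale)
    finally show ?thesis
      by (simp add: gradx_def inner_vec_def mult.commute)
  qed
  then show ?thesis
    using D by (metis (no_types, lifting) ext)
qed

section \<open>State trajectories\<close>

locale relaxed_dynamics =
  fixes U :: "(real^'k) set" and f :: "real^'n \<Rightarrow> real^'k \<Rightarrow> real^'n"
    and tf :: real and x0 :: "real^'n"
  assumes compact_U: "compact U" and tf_pos: "0 < tf" and dyn: "dynamics_assms U f"
begin

lemma f_continuous: "continuous_on (UNIV \<times> U) (\<lambda>(x, u). f x u)"
  using dyn by (auto simp: dynamics_assms_def intro: locally_lipschitz_on_imp_continuous_on)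

lemma continuous_along_curve:
  fixes \<phi> :: "real^'n \<Rightarrow> real^'k \<Rightarrow> 'b::topological_space"
  assumes "continuous_on (UNIV \<times> U) (\<lambda>(x, u). \<phi> x u)" "continuous_on S y"
  shows "continuous_on (S \<times> U) (\<lambda>(t, u). \<phi> (y t) u)"
proof -
  have "continuous_on (S \<times> U) (\<lambda>z. (\<lambda>(x, u). \<phi> x u) (y (fst z), snd z))"
    by (rule continuous_on_compose2[OF assms(1)])
      (auto intro!: continuous_intros continuous_on_compose2[OF assms(2)])
  then show ?thesis
    by (simp add: case_prod_unfold)
qed

lemma growth_bound:
  obtains K where "0 < K" "\<And>x u. u \<in> U \<Longrightarrow> norm (f x u) \<le> K * (norm x + 1)"
  using dyn by (auto simp: dynamics_assms_def)

lemma f_lipschitz_on_cball: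
  obtains C where "0 < C" "\<And>u x y. u \<in> U \<Longrightarrow> x \<in> cball 0 R \<Longrightarrow> y \<in> cball 0 R \<Longrightarrow>
    norm (f x u - f y u) \<le> C * norm (x - y)"
proof -
  obtain C where "0 < C" "\<And>u x y. u \<in> U \<Longrightarrow> x \<in> cball 0 R \<Longrightarrow> y \<in> cball 0 R \<Longrightarrow>
      dist (f x u) (f y u) \<le> C * dist x y"
    using lipschitz_uniform_on_compact[OF _ compact_U compact_cball] dyn
    unfolding dynamics_assms_def by metis
  then show ?thesis
    by (intro that) (auto simp: dist_norm)
qed

lemma state_trajectory_has_integral:
  assumes "is_state_trajectory f tf x0 m y" "0 \<le> s" "s \<le> t" "t \<le> tf"
  shows "((\<lambda>t. \<integral>u. f (y t) u \<partial>m t) has_integral (y t - y s)) {s..t}"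
  using assms unfolding is_state_trajectory_def by (intro ac_on_AE_has_integral) auto

lemma state_trajectory_continuous:
  "is_state_trajectory f tf x0 m y \<Longrightarrow> continuous_on {0..tf} y"
  by (auto simp: is_state_trajectory_def intro: ac_on_continuous_on)

text \<open>The dynamics are only locally Lipschitz, so they are composed with the projection onto a ball,
  which is Lipschitz with constant one and does not increase norms. The truncated field is globally
  Lipschitz and obeys the same linear growth bound; hence its solution stays inside the ball, where
  the truncation changes nothing.\<close>

lemma state_trajectory_exists:
  assumes m: "relaxed_control U tf m"
  shows "\<exists>y. is_state_trajectory f tf x0 m y"
proof -
  obtain K where K: "0 < K" "\<And>x u. u \<in> U \<Longrightarrow> norm (f x u) \<le> K * (norm x + 1)"
    using growth_bound by metis
  \<comment> \<open>The radius is the Gronwall bound for solutions of a field with growth constant \<open>K\<close>.\<close>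
  define R where "R = 2 * (norm x0 + K * tf) * exp (2 * K * tf)"
  have R: "0 \<le> R"
    using K(1) tf_pos by (simp add: R_def)
  obtain C where C: "0 < C" "\<And>u x y. u \<in> U \<Longrightarrow> x \<in> cball 0 R \<Longrightarrow> y \<in> cball 0 R \<Longrightarrow>
    norm (f x u - f y u) \<le> C * norm (x - y)"
    using f_lipschitz_on_cball by metis
  define \<pi> where "\<pi> = closest_point (cball 0 R :: (real^'n) set)"
  have \<pi>_in: "\<pi> y \<in> cball 0 R" for y
    unfolding \<pi>_def using R by (intro closest_point_in_set) auto
  have \<pi>_lip: "norm (\<pi> y - \<pi> z) \<le> norm (y - z)" for y z
    using closest_point_lipschitz[of "cball 0 R" y z] R by (simp add: \<pi>_def dist_norm)
  have \<pi>_self: "\<pi> y = y" if "norm y \<le> R" for y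
    unfolding \<pi>_def using that by (intro closest_point_self) auto
  have \<pi>_norm: "norm (\<pi> y) \<le> norm y" for y
    using \<pi>_lip[of y 0] \<pi>_self[of 0] R by simp
  have \<pi>_cont: "continuous_on S (\<lambda>t. \<pi> (y t))" if "continuous_on S y" for S and y :: "real \<Rightarrow> real^'n"
  proof (rule continuous_on_compose2[OF _ that])
    show "continuous_on UNIV \<pi>"
      unfolding \<pi>_def using R by (intro continuous_on_closest_point) auto
  qed simp
  define g where "g t y = (\<integral>u. f (\<pi> y) u \<partial>m t)" for t y
  have f_int: "integrable (m t) (f y)" if "t \<in> {0..tf}" for t y
    using integrable_prob_measures_on[OF compact_U relaxed_controlD[OF m that]
      continuous_on_slice[OF f_continuous]] by simp
  have g_lip: "norm (g t y - g t z) \<le> C * norm (y - z)" if t: "t \<in> {0..tf}" for t y z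
  proof -
    have "norm (\<integral>u. f (\<pi> y) u - f (\<pi> z) u \<partial>m t) \<le> C * norm (y - z)"
      using C \<pi>_lip[of y z] \<pi>_in
      by (intro norm_integral_prob_measures_on_le[OF relaxed_controlD[OF m t]])
        (meson mult_left_mono order_trans less_imp_le)
    then show ?thesis
      using f_int[OF t] by (simp add: g_def)
  qed
  have g_int: "(\<lambda>t. g t (y t)) integrable_on {0..tf}" if "continuous_on {0..tf} y" for y
    unfolding g_def
    using has_integral_integral_lebesgue_on[OF relaxed_integral_integrable[OF m compact_U _
        continuous_along_curve[OF f_continuous \<pi>_cont[OF that]]]] tf_pos
    by (auto intro: has_integral_integrable)
  obtain y where y: "continuous_on {0..tf} y"
    "\<And>t. t \<in> {0..tf} \<Longrightarrow> y t = x0 + integral {0..t} (\<lambda>s. g s (y s))"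
    using integral_equation_solution_exists[where ?x0.0 = x0, OF less_imp_le[OF tf_pos] C(1) g_lip g_int]
    by metis
  define G where "G t = g t (y t)" for t
  have G_int: "G integrable_on {s..t}" if "0 \<le> s" "t \<le> tf" for s t
    using integrable_on_subinterval[OF g_int[OF y(1)], of s t] that by (auto simp: G_def[abs_def])
  have y_int: "(G has_integral (y t - y s)) {s..t}" if "0 \<le> s" "s \<le> t" "t \<le> tf" for s t
  proof -
    have "y t - y s = integral {s..t} G"
      using Henstock_Kurzweil_Integration.integral_combine[of 0 s t G] G_int[of 0 t] that
        y(2)[of s] y(2)[of t] by (auto simp: G_def[abs_def] algebra_simps)
    then show ?thesis
      using G_int[of s t] that by (simp add: has_integral_integral)
  qed
  have y0: "y 0 = x0"
    using y(2)[of 0] tf_pos by simp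
  have G_le: "norm (G t) \<le> K * norm (y t) + K" if "t \<in> {0..tf}" for t
    unfolding G_def g_def
  proof (rule norm_integral_prob_measures_on_le[OF relaxed_controlD[OF m that]])
    fix u assume "u \<in> U"
    then have "norm (f (\<pi> (y t)) u) \<le> K * (norm (\<pi> (y t)) + 1)"
      by (rule K)
    also have "\<dots> \<le> K * (norm (y t) + 1)"
      using \<pi>_norm K(1) by (intro mult_left_mono) auto
    finally show "norm (f (\<pi> (y t)) u) \<le> K * norm (y t) + K"
      by (simp add: algebra_simps)
  qed
  have y_le: "norm (y t) \<le> R" if "t \<in> {0..tf}" for t
    unfolding R_def y0[symmetric]
    using K(1) tf_pos y_int G_le that by (intro gronwall_has_integral[OF _ _ _ y(1)]) auto
  have "is_state_trajectory f tf x0 m y"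
    unfolding is_state_trajectory_def
  proof (intro conjI)
    show "ac_on 0 tf y"
    proof (rule ac_on_lipschitz)
      fix s t assume st: "0 \<le> s" "s \<le> t" "t \<le> tf"
      have "norm (G r) \<le> K * R + K" if "r \<in> {s..t}" for r
      proof -
        have "norm (G r) \<le> K * norm (y r) + K"
          using that st by (intro G_le) auto
        also have "\<dots> \<le> K * R + K"
          using y_le[of r] that st K(1) by (intro add_mono mult_left_mono) auto
        finally show ?thesis .
      qed
      then show "norm (y t - y s) \<le> (K * R + K) * (t - s)"
        by (rule has_integral_norm_le_interval[OF y_int[OF st] st(2)])
    qed
    show "y 0 = x0" by (rule y0)
    have "AE t in lebesgue_on {0..tf}.
        ((\<lambda>s. x0 + integral {0..s} G) has_vector_derivative G t) (at t within {0..tf})"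
      using tf_pos by (intro AE_has_vector_derivative_indefinite_integral G_int) auto
    then show "AE t in lebesgue_on {0..tf}.
        (y has_vector_derivative (\<integral>u. f (y t) u \<partial>m t)) (at t within {0..tf})"
    proof (rule AE_mp, intro AE_I2 impI)
      fix t assume "t \<in> space (lebesgue_on {0..tf})"
        and D: "((\<lambda>s. x0 + integral {0..s} G) has_vector_derivative G t) (at t within {0..tf})"
      then have t: "t \<in> {0..tf}" by simp
      have "(y has_vector_derivative G t) (at t within {0..tf})"
        by (rule has_vector_derivative_transform[OF t _ D]) (use y(2) in \<open>simp add: G_def[abs_def]\<close>)
      then show "(y has_vector_derivative (\<integral>u. f (y t) u \<partial>m t)) (at t within {0..tf})"
        using \<pi>_self[OF y_le[OF t]] by (simp add: G_def g_def)
    qed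
  qed
  then show ?thesis by blast
qed

lemma is_state_trajectory_state_trajectory:
  "relaxed_control U tf m \<Longrightarrow> is_state_trajectory f tf x0 m (state_trajectory f tf x0 m)"
  unfolding state_trajectory_def using state_trajectory_exists by (rule someI_ex)

text \<open>The Gronwall bound involves the control only through the growth constant, which is the same for
  all controls. Every state that occurs below thus lies in one ball, where the data are uniformly
  Lipschitz.\<close>

lemma state_trajectories_bounded:
  obtains R where "0 \<le> R"
    "\<And>m y t. relaxed_control U tf m \<Longrightarrow> is_state_trajectory f tf x0 m y \<Longrightarrow> t \<in> {0..tf} \<Longrightarrow> norm (y t) \<le> R"
proof -
  obtain K where K: "0 < K" "\<And>x u. u \<in> U \<Longrightarrow> norm (f x u) \<le> K * (norm x + 1)"
    using growth_bound by metis
  show thesis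
  proof (rule that)
    show "0 \<le> 2 * (norm x0 + K * tf) * exp (2 * K * tf)"
      using K(1) tf_pos by simp
    fix m y t assume m: "relaxed_control U tf m" and y: "is_state_trajectory f tf x0 m y" and t: "t \<in> {0..tf}"
    have y0: "y 0 = x0"
      using y by (simp add: is_state_trajectory_def)
    have "norm (\<integral>u. f (y t) u \<partial>m t) \<le> K * norm (y t) + K" if "t \<in> {0..tf}" for t
      using K(2)[of _ "y t"]
      by (intro norm_integral_prob_measures_on_le[OF relaxed_controlD[OF m that]]) (simp add: algebra_simps)
    then show "norm (y t) \<le> 2 * (norm x0 + K * tf) * exp (2 * K * tf)"
      unfolding y0[symmetric] using K(1) tf_pos t state_trajectory_has_integral[OF y]
      by (intro gronwall_has_integral[OF _ _ _ state_trajectory_continuous[OF y]]) auto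
  qed
qed

lemma integral_mix_control:
  fixes \<phi> :: "real^'k \<Rightarrow> 'b::euclidean_space"
  assumes "relaxed_control U tf \<mu>" "relaxed_control U tf \<nu>" "0 \<le> l" "l \<le> 1"
    and "t \<in> {0..tf}" "continuous_on U \<phi>"
  shows "(\<integral>u. \<phi> u \<partial>mix_control l \<nu> \<mu> t) = l *\<^sub>R (\<integral>u. \<phi> u \<partial>\<nu> t) + (1 - l) *\<^sub>R (\<integral>u. \<phi> u \<partial>\<mu> t)"
  using relaxed_controlD[OF assms(1,5)] relaxed_controlD[OF assms(2,5)] unfolding mix_control_def
  by (intro integral_mix_measure assms(3,4) integrable_prob_measures_on[OF compact_U _ assms(6)])
    (auto simp: prob_measures_on_def)

text \<open>The velocities of the two trajectories differ by a Lipschitz term in the distance of the states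
  and by \<open>l\<close> times a bounded term that comes from the change of the control. In particular the
  trajectory of \<open>\<mu>\<close> is unique: take \<open>l = 0\<close>.\<close>

lemma state_trajectory_mix_close:
  assumes \<mu>: "relaxed_control U tf \<mu>" and \<nu>: "relaxed_control U tf \<nu>"
    and x: "is_state_trajectory f tf x0 \<mu> x"
  obtains B where
    "\<And>l y t. 0 \<le> l \<Longrightarrow> l \<le> 1 \<Longrightarrow> is_state_trajectory f tf x0 (mix_control l \<nu> \<mu>) y \<Longrightarrow> t \<in> {0..tf} \<Longrightarrow>
       norm (y t - x t) \<le> B * l"
proof -
  obtain K where K: "0 < K" "\<And>x u. u \<in> U \<Longrightarrow> norm (f x u) \<le> K * (norm x + 1)"
    using growth_bound by metis
  obtain R where R: "0 \<le> R"
    "\<And>m y t. relaxed_control U tf m \<Longrightarrow> is_state_trajectory f tf x0 m y \<Longrightarrow> t \<in> {0..tf} \<Longrightarrow> norm (y t) \<le> R"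
    using state_trajectories_bounded by metis
  obtain C where C: "0 < C" "\<And>u x y. u \<in> U \<Longrightarrow> x \<in> cball 0 R \<Longrightarrow> y \<in> cball 0 R \<Longrightarrow>
    norm (f x u - f y u) \<le> C * norm (x - y)"
    using f_lipschitz_on_cball by metis
  define M where "M = K * (R + 1)"
  have M: "0 \<le> M" using K(1) R(1) by (simp add: M_def)
  show thesis
  proof (rule that)
    fix l y t
    assume l: "0 \<le> l" "l \<le> 1" and y: "is_state_trajectory f tf x0 (mix_control l \<nu> \<mu>) y" and t: "t \<in> {0..tf}"
    have mix: "relaxed_control U tf (mix_control l \<nu> \<mu>)"
      by (rule relaxed_control_mix[OF \<mu> \<nu> compact_U l])
    define F where "F t = (\<integral>u. f (y t) u \<partial>mix_control l \<nu> \<mu> t) - (\<integral>u. f (x t) u \<partial>\<mu> t)" for t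
    have start: "y 0 = x0" "x 0 = x0"
      using x y by (auto simp: is_state_trajectory_def)
    have "norm (y t - x t) \<le> 2 * (norm (y 0 - x 0) + 2 * M * l * tf) * exp (2 * C * tf)"
    proof (rule gronwall_has_integral[of C "2 * M * l" tf "\<lambda>t. y t - x t" F t])
      show "continuous_on {0..tf} (\<lambda>t. y t - x t)"
        by (intro continuous_intros state_trajectory_continuous[OF x] state_trajectory_continuous[OF y])
      show "(F has_integral (y t - x t - (y 0 - x 0))) {0..t}" if "t \<in> {0..tf}" for t
      proof -
        have "(F has_integral ((y t - y 0) - (x t - x 0))) {0..t}"
          unfolding F_def using that
          by (intro has_integral_diff state_trajectory_has_integral[OF x] state_trajectory_has_integral[OF y]) auto
        then show ?thesis by (simp add: algebra_simps)
      qed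
      show "norm (F t) \<le> C * norm (y t - x t) + 2 * M * l" if t: "t \<in> {0..tf}" for t
      proof -
        have in_ball: "y t \<in> cball 0 R" "x t \<in> cball 0 R"
          using R(2)[OF mix y t] R(2)[OF \<mu> x t] by auto
        have f_le: "norm (f (y t) u) \<le> M" if "u \<in> U" for u
        proof -
          have "norm (f (y t) u) \<le> K * (norm (y t) + 1)"
            by (rule K(2)[OF that])
          also have "\<dots> \<le> M"
            unfolding M_def using in_ball K(1) by (intro mult_left_mono) auto
          finally show ?thesis .
        qed
        have fc: "continuous_on U (f z)" for z
          by (rule continuous_on_slice[OF f_continuous]) simp
        have F_eq: "F t = (\<integral>u. f (y t) u - f (x t) u \<partial>\<mu> t) + l *\<^sub>R ((\<integral>u. f (y t) u \<partial>\<nu> t) - (\<integral>u. f (y t) u \<partial>\<mu> t))"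
          using integrable_prob_measures_on[OF compact_U relaxed_controlD[OF \<mu> t] fc]
          unfolding F_def integral_mix_control[OF \<mu> \<nu> l t fc] by (simp add: algebra_simps)
        have "norm (\<integral>u. f (y t) u - f (x t) u \<partial>\<mu> t) \<le> C * norm (y t - x t)"
          by (intro norm_integral_prob_measures_on_le[OF relaxed_controlD[OF \<mu> t]] C(2) in_ball)
        moreover have "norm (l *\<^sub>R ((\<integral>u. f (y t) u \<partial>\<nu> t) - (\<integral>u. f (y t) u \<partial>\<mu> t))) \<le> l * (M + M)"
          using l f_le norm_integral_prob_measures_on_le[OF relaxed_controlD[OF \<mu> t], of "f (y t)" M]
            norm_integral_prob_measures_on_le[OF relaxed_controlD[OF \<nu> t], of "f (y t)" M]
          by (auto intro!: mult_left_mono norm_triangle_le_diff)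
        ultimately show ?thesis
          unfolding F_eq by (intro norm_triangle_le) (simp add: algebra_simps)
      qed
    qed (use C M l tf_pos t in auto)
    then show "norm (y t - x t) \<le> 4 * M * tf * exp (2 * C * tf) * l"
      by (simp add: start algebra_simps)
  qed
qed

end

section \<open>The first variation of the cost\<close>

text \<open>The estimate at \<open>l = 0\<close> forces \<open>J 0 = J0\<close>, so the two may be given by different expressions.\<close>

lemma has_right_derivative_quadratic_remainder:
  fixes J :: "real \<Rightarrow> real"
  assumes "\<And>l. 0 \<le> l \<Longrightarrow> l \<le> 1 \<Longrightarrow> \<bar>J l - J0 - l * I\<bar> \<le> C * l\<^sup>2"
  shows "(J has_real_derivative I) (at_right 0)"
proof -
  have J0: "J 0 = J0"
    using assms[of 0] by simp
  have "((\<lambda>l. (J l - J 0) / (l - 0) - I) \<longlongrightarrow> 0) (at_right 0)"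
  proof (rule Lim_null_comparison)
    show "\<forall>\<^sub>F l in at_right 0. norm ((J l - J 0) / (l - 0) - I) \<le> C * l"
      unfolding eventually_at_right_field
    proof (intro exI[of _ 1] conjI allI impI)
      fix l :: real assume l: "0 < l" "l < 1"
      have "(J l - J 0) / (l - 0) - I = (J l - J0 - l * I) / l"
        using l by (simp add: J0 field_simps)
      then have "norm ((J l - J 0) / (l - 0) - I) = \<bar>J l - J0 - l * I\<bar> / l"
        using l by (simp add: abs_divide)
      also have "\<dots> \<le> C * l\<^sup>2 / l"
        using assms[of l] l by (intro divide_right_mono) auto
      finally show "norm ((J l - J 0) / (l - 0) - I) \<le> C * l"
        using l by (simp add: power2_eq_square)
    qed simp
    have "((\<lambda>l. C * l) \<longlongrightarrow> C * 0) (at_right 0)"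
      by (intro tendsto_intros)
    then show "((\<lambda>l. C * l) \<longlongrightarrow> 0) (at_right 0)" by simp
  qed
  then show ?thesis
    unfolding has_field_derivative_iff by (rule LIM_zero_cancel)
qed

locale relaxed_control_problem = relaxed_dynamics U f tf x0
  for U :: "(real^'k) set" and f :: "real^'n \<Rightarrow> real^'k \<Rightarrow> real^'n" and tf x0 +
  fixes L :: "real^'n \<Rightarrow> real^'k \<Rightarrow> real"
  assumes cost: "cost_assms U L"
begin

lemma L_continuous: "continuous_on (UNIV \<times> U) (\<lambda>(x, u). L x u)"
  using cost by (auto simp: cost_assms_def intro: locally_lipschitz_on_imp_continuous_on)

lemma Dx_continuous: "continuous_on (UNIV \<times> U) (\<lambda>(x, u). Dx f x u)"
  using dyn by (auto simp: dynamics_assms_def intro: locally_lipschitz_on_imp_continuous_on)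

lemma gradx_continuous: "continuous_on (UNIV \<times> U) (\<lambda>(x, u). gradx L x u)"
  using cost by (auto simp: cost_assms_def intro: locally_lipschitz_on_imp_continuous_on)

lemma costate_integrand_continuous:
  "continuous_on U (\<lambda>u. transpose (Dx f x u) *v q + gradx L x u)"
proof -
  have "continuous_on U (\<lambda>u. Dx f x u)" "continuous_on U (\<lambda>u. gradx L x u)"
    by (auto intro!: continuous_on_slice[OF Dx_continuous] continuous_on_slice[OF gradx_continuous])
  then show ?thesis
    by (simp only: matrix_vector_mult_def transpose_def vec_lambda_beta)
      (intro continuous_intros continuous_on_vec_lambda)
qed

lemma L_lipschitz_on_cball:
  obtains C where "0 < C" "\<And>u x y. u \<in> U \<Longrightarrow> x \<in> cball 0 R \<Longrightarrow> y \<in> cball 0 R \<Longrightarrow>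
    \<bar>L x u - L y u\<bar> \<le> C * norm (x - y)"
proof -
  obtain C where "0 < C" "\<And>u x y. u \<in> U \<Longrightarrow> x \<in> cball 0 R \<Longrightarrow> y \<in> cball 0 R \<Longrightarrow>
      dist (L x u) (L y u) \<le> C * dist x y"
    using lipschitz_uniform_on_compact[OF _ compact_U compact_cball] cost
    unfolding cost_assms_def by metis
  then show ?thesis
    by (intro that) (auto simp: dist_norm)
qed

lemma f_taylor_on_cball:
  obtains C where "0 < C" "\<And>u x y. u \<in> U \<Longrightarrow> x \<in> cball 0 R \<Longrightarrow> y \<in> cball 0 R \<Longrightarrow>
    norm (f y u - f x u - Dx f x u *v (y - x)) \<le> C * (norm (y - x))\<^sup>2"
proof -
  obtain C where C: "0 < C" "\<And>u x y. u \<in> U \<Longrightarrow> x \<in> cball 0 R \<Longrightarrow> y \<in> cball 0 R \<Longrightarrow>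
      dist (Dx f x u) (Dx f y u) \<le> C * dist x y"
    using lipschitz_uniform_on_compact[OF _ compact_U compact_cball] dyn
    unfolding dynamics_assms_def by metis
  show thesis
  proof (rule that[OF C(1)])
    fix u and x y :: "real^'n" assume u: "u \<in> U" and xy: "x \<in> cball 0 R" "y \<in> cball 0 R"
    show "norm (f y u - f x u - Dx f x u *v (y - x)) \<le> C * (norm (y - x))\<^sup>2"
    proof (rule taylor_remainder_le)
      show "((\<lambda>y. f y u) has_derivative (\<lambda>h. Dx f z u *v h)) (at z)" for z
        using dyn u unfolding Dx_def dynamics_assms_def jacobian_works by blast
      fix z h assume "z \<in> closed_segment x y"
      then have "z \<in> cball 0 R"
        using xy closed_segment_subset[OF _ _ convex_cball] by blast
      have "norm (Dx f z u *v h - Dx f x u *v h) = norm ((Dx f z u - Dx f x u) *v h)"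
        by (simp add: matrix_vector_mult_diff_rdistrib)
      also have "\<dots> \<le> norm (Dx f z u - Dx f x u) * norm h"
        by (rule norm_matrix_vector_mult_le)
      also have "\<dots> \<le> C * norm (z - x) * norm h"
        using C(2)[OF u \<open>z \<in> cball 0 R\<close> xy(1)] by (intro mult_right_mono) (auto simp: dist_norm)
      finally show "norm (Dx f z u *v h - Dx f x u *v h) \<le> C * norm (z - x) * norm h" .
    qed (use C(1) in simp)
  qed
qed

lemma L_taylor_on_cball:
  obtains C where "0 < C" "\<And>u x y. u \<in> U \<Longrightarrow> x \<in> cball 0 R \<Longrightarrow> y \<in> cball 0 R \<Longrightarrow>
    \<bar>L y u - L x u - gradx L x u \<bullet> (y - x)\<bar> \<le> C * (norm (y - x))\<^sup>2"
proof -
  obtain C where C: "0 < C" "\<And>u x y. u \<in> U \<Longrightarrow> x \<in> cball 0 R \<Longrightarrow> y \<in> cball 0 R \<Longrightarrow>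
      dist (gradx L x u) (gradx L y u) \<le> C * dist x y"
    using lipschitz_uniform_on_compact[OF _ compact_U compact_cball] cost
    unfolding cost_assms_def by metis
  show thesis
  proof (rule that[OF C(1)])
    fix u and x y :: "real^'n" assume u: "u \<in> U" and xy: "x \<in> cball 0 R" "y \<in> cball 0 R"
    have "norm (L y u - L x u - gradx L x u \<bullet> (y - x)) \<le> C * (norm (y - x))\<^sup>2"
    proof (rule taylor_remainder_le)
      show "((\<lambda>y. L y u) has_derivative (\<lambda>h. gradx L z u \<bullet> h)) (at z)" for z
        using cost u unfolding cost_assms_def by (intro has_derivative_gradx) blast
      fix z h assume "z \<in> closed_segment x y"
      then have "z \<in> cball 0 R"
        using xy closed_segment_subset[OF _ _ convex_cball] by blast
      have "norm (gradx L z u \<bullet> h - gradx L x u \<bullet> h) = \<bar>(gradx L z u - gradx L x u) \<bullet> h\<bar>"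
        by (simp add: inner_diff_left)
      also have "\<dots> \<le> norm (gradx L z u - gradx L x u) * norm h"
        by (rule Cauchy_Schwarz_ineq2)
      also have "\<dots> \<le> C * norm (z - x) * norm h"
        using C(2)[OF u \<open>z \<in> cball 0 R\<close> xy(1)] by (intro mult_right_mono) (auto simp: dist_norm)
      finally show "norm (gradx L z u \<bullet> h - gradx L x u \<bullet> h) \<le> C * norm (z - x) * norm h" .
    qed (use C(1) in simp)
    then show "\<bar>L y u - L x u - gradx L x u \<bullet> (y - x)\<bar> \<le> C * (norm (y - x))\<^sup>2"
      by simp
  qed
qed

text \<open>For a state \<open>x\<close> and a control value \<open>m\<close> at some instant, a perturbed state \<open>y\<close>, a control value \<open>n\<close>
  mixed in with weight \<open>l\<close>, and a costate \<open>q\<close>, this is the perturbation of the running cost, minus its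
  predicted first-order part, plus the time derivative of \<open>q \<bullet> (y - x)\<close> along the state and costate
  equations.\<close>

definition defect ::
  "(real^'k) measure \<Rightarrow> (real^'k) measure \<Rightarrow> real \<Rightarrow> real^'n \<Rightarrow> real^'n \<Rightarrow> real^'n \<Rightarrow> real" where
  "defect m n l x y q =
     (l * (\<integral>u. L y u \<partial>n) + (1 - l) * (\<integral>u. L y u \<partial>m)) - (\<integral>u. L x u \<partial>m)
       - l * (hamiltonian f L x n q - hamiltonian f L x m q)
       + (q \<bullet> ((l *\<^sub>R (\<integral>u. f y u \<partial>n) + (1 - l) *\<^sub>R (\<integral>u. f y u \<partial>m)) - (\<integral>u. f x u \<partial>m))
          + - (\<integral>u. transpose (Dx f x u) *v q + gradx L x u \<partial>m) \<bullet> (y - x))"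

text \<open>With \<open>k(u)\<close> the increment of \<open>q \<bullet> f(\<cdot>, u) + L(\<cdot>, u)\<close> from \<open>x\<close> to \<open>y\<close>, the defect regroups into the
  \<open>m\<close>-average of the first-order Taylor remainder of that function, which is quadratic in \<open>y - x\<close>,
  and \<open>l\<close> times the difference of the \<open>n\<close>- and \<open>m\<close>-averages of \<open>k\<close>, which is linear in \<open>y - x\<close>. The
  velocity of the costate contributes exactly the linear term of that Taylor remainder.\<close>

lemma defect_le:
  assumes "0 \<le> P"
  obtains C where "0 \<le> C"
    "\<And>m n l x y q. m \<in> prob_measures_on U \<Longrightarrow> n \<in> prob_measures_on U \<Longrightarrow> 0 \<le> l \<Longrightarrow>
       x \<in> cball 0 R \<Longrightarrow> y \<in> cball 0 R \<Longrightarrow> norm q \<le> P \<Longrightarrow>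
       \<bar>defect m n l x y q\<bar>
       \<le> C * ((norm (y - x))\<^sup>2 + l * norm (y - x))"
proof -
  obtain C1 where C1: "0 < C1" "\<And>u x y. u \<in> U \<Longrightarrow> x \<in> cball 0 R \<Longrightarrow> y \<in> cball 0 R \<Longrightarrow>
    norm (f y u - f x u - Dx f x u *v (y - x)) \<le> C1 * (norm (y - x))\<^sup>2"
    using f_taylor_on_cball by metis
  obtain C2 where C2: "0 < C2" "\<And>u x y. u \<in> U \<Longrightarrow> x \<in> cball 0 R \<Longrightarrow> y \<in> cball 0 R \<Longrightarrow>
    \<bar>L y u - L x u - gradx L x u \<bullet> (y - x)\<bar> \<le> C2 * (norm (y - x))\<^sup>2"
    using L_taylor_on_cball by metis
  obtain C3 where C3: "0 < C3" "\<And>u x y. u \<in> U \<Longrightarrow> x \<in> cball 0 R \<Longrightarrow> y \<in> cball 0 R \<Longrightarrow>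
    norm (f x u - f y u) \<le> C3 * norm (x - y)"
    using f_lipschitz_on_cball by metis
  obtain C4 where C4: "0 < C4" "\<And>u x y. u \<in> U \<Longrightarrow> x \<in> cball 0 R \<Longrightarrow> y \<in> cball 0 R \<Longrightarrow>
    \<bar>L x u - L y u\<bar> \<le> C4 * norm (x - y)"
    using L_lipschitz_on_cball by metis
  define A where "A = P * C1 + C2"
  define B where "B = P * C3 + C4"
  have AB: "0 \<le> A" "0 \<le> B"
    using \<open>0 \<le> P\<close> C1 C2 C3 C4 by (auto simp: A_def B_def)
  show thesis
  proof (rule that)
    show "0 \<le> A + 2 * B" using AB by simp
    fix m n :: "(real^'k) measure" and l :: real and x y q :: "real^'n"
    assume m: "m \<in> prob_measures_on U" and n: "n \<in> prob_measures_on U" and l: "0 \<le> l"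
      and x: "x \<in> cball 0 R" and y: "y \<in> cball 0 R" and q: "norm q \<le> P"
    let ?d = "norm (y - x)"
    let ?G = "\<lambda>u. transpose (Dx f x u) *v q + gradx L x u"
    define k where "k u = (q \<bullet> f y u + L y u) - (q \<bullet> f x u + L x u)" for u
    have cont: "continuous_on U (f z)" "continuous_on U (L z)" for z
      by (auto intro: continuous_on_slice[OF f_continuous] continuous_on_slice[OF L_continuous])
    have fL_int: "integrable p (f z)" "integrable p (L z)" if "p \<in> prob_measures_on U" for p z
      using integrable_prob_measures_on[OF compact_U that] cont by auto
    have G_int: "integrable m ?G"
      by (rule integrable_prob_measures_on[OF compact_U m costate_integrand_continuous])
    have k_eq: "(\<integral>u. k u \<partial>p) = (q \<bullet> (\<integral>u. f y u \<partial>p) + (\<integral>u. L y u \<partial>p)) - hamiltonian f L x p q"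
      "hamiltonian f L x p q = q \<bullet> (\<integral>u. f x u \<partial>p) + (\<integral>u. L x u \<partial>p)"
      "integrable p k"
      if "p \<in> prob_measures_on U" for p
      using fL_int[OF that] by (simp_all add: k_def[abs_def] hamiltonian_def)
    have "(\<integral>u. k u - ?G u \<bullet> (y - x) \<partial>m) = (\<integral>u. k u \<partial>m) - (\<integral>u. ?G u \<partial>m) \<bullet> (y - x)"
      using k_eq(3)[OF m] G_int by simp
    then have "defect m n l x y q
      = (\<integral>u. k u - ?G u \<bullet> (y - x) \<partial>m) + l * ((\<integral>u. k u \<partial>n) - (\<integral>u. k u \<partial>m))"
      unfolding defect_def k_eq(1)[OF m] k_eq(1)[OF n] k_eq(2)[OF m] k_eq(2)[OF n]
      by (simp add: algebra_simps)
    moreover have "norm (\<integral>u. k u - ?G u \<bullet> (y - x) \<partial>m) \<le> A * ?d\<^sup>2"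
    proof (rule norm_integral_prob_measures_on_le[OF m])
      fix u assume u: "u \<in> U"
      have "k u - ?G u \<bullet> (y - x) = q \<bullet> (f y u - f x u - Dx f x u *v (y - x)) + (L y u - L x u - gradx L x u \<bullet> (y - x))"
        by (simp add: k_def inner_add_left inner_diff_right dot_lmul_matrix matrix_vector_mult_diff_distrib)
      also have "norm \<dots> \<le> norm q * norm (f y u - f x u - Dx f x u *v (y - x)) + \<bar>L y u - L x u - gradx L x u \<bullet> (y - x)\<bar>"
        using Cauchy_Schwarz_ineq2 by (intro norm_triangle_le add_mono) auto
      also have "\<dots> \<le> P * (C1 * ?d\<^sup>2) + C2 * ?d\<^sup>2"
        using \<open>0 \<le> P\<close> q C1(2)[OF u x y] C2(2)[OF u x y] by (intro add_mono mult_mono) auto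
      finally show "norm (k u - ?G u \<bullet> (y - x)) \<le> A * ?d\<^sup>2"
        by (simp add: A_def algebra_simps)
    qed
    moreover have "\<bar>l * ((\<integral>u. k u \<partial>n) - (\<integral>u. k u \<partial>m))\<bar> \<le> l * (B * ?d + B * ?d)"
    proof -
      have k_le: "norm (k u) \<le> B * ?d" if u: "u \<in> U" for u
      proof -
        have "k u = q \<bullet> (f y u - f x u) + (L y u - L x u)"
          by (simp add: k_def inner_diff_right)
        also have "norm \<dots> \<le> norm q * norm (f y u - f x u) + \<bar>L y u - L x u\<bar>"
          using Cauchy_Schwarz_ineq2 by (intro norm_triangle_le add_mono) auto
        also have "\<dots> \<le> P * (C3 * ?d) + C4 * ?d"
          using \<open>0 \<le> P\<close> q C3(2)[OF u y x] C4(2)[OF u y x] by (intro add_mono mult_mono) auto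
        finally show ?thesis
          by (simp add: B_def algebra_simps)
      qed
      have "\<bar>\<integral>u. k u \<partial>p\<bar> \<le> B * ?d" if "p \<in> prob_measures_on U" for p
        using norm_integral_prob_measures_on_le[OF that k_le] by simp
      from this[OF n] this[OF m] have "\<bar>(\<integral>u. k u \<partial>n) - (\<integral>u. k u \<partial>m)\<bar> \<le> B * ?d + B * ?d"
        by simp
      then show ?thesis
        using l by (simp add: abs_mult mult_left_mono)
    qed
    moreover have "A * ?d\<^sup>2 + l * (B * ?d + B * ?d) \<le> (A + 2 * B) * (?d\<^sup>2 + l * ?d)"
      using AB l by (simp add: algebra_simps)
    ultimately show "\<bar>defect m n l x y q\<bar> \<le> (A + 2 * B) * (?d\<^sup>2 + l * ?d)"
      by simp
  qed
qed

text \<open>The derivative of \<open>p \<bullet> (y - x)\<close> integrates to zero, as \<open>y = x\<close> at the initial and \<open>p = 0\<close> at the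
  final time. Adding it to the integrand of the cost difference therefore changes nothing, and what
  remains is the integral of the defect, which is of order \<open>l\<^sup>2\<close> because \<open>y - x\<close> is of order \<open>l\<close>.\<close>

lemma cost_expansion:
  assumes \<mu>: "relaxed_control U tf \<mu>" and \<nu>: "relaxed_control U tf \<nu>"
    and x: "is_state_trajectory f tf x0 \<mu> x" and p: "is_costate_trajectory f L tf \<mu> x p"
  obtains J0 C where
    "\<And>l. 0 \<le> l \<Longrightarrow> l \<le> 1 \<Longrightarrow>
       \<bar>cost f L tf x0 (mix_control l \<nu> \<mu>) - J0
         - l * (\<integral>t. hamiltonian f L (x t) (\<nu> t) (p t) - hamiltonian f L (x t) (\<mu> t) (p t) \<partial>lebesgue_on {0..tf})\<bar>
       \<le> C * l\<^sup>2"
proof -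
  obtain R where R:
    "\<And>m y t. relaxed_control U tf m \<Longrightarrow> is_state_trajectory f tf x0 m y \<Longrightarrow> t \<in> {0..tf} \<Longrightarrow> norm (y t) \<le> R"
    using state_trajectories_bounded by metis
  obtain B where B:
    "\<And>l y t. 0 \<le> l \<Longrightarrow> l \<le> 1 \<Longrightarrow> is_state_trajectory f tf x0 (mix_control l \<nu> \<mu>) y \<Longrightarrow> t \<in> {0..tf} \<Longrightarrow>
       norm (y t - x t) \<le> B * l"
    using state_trajectory_mix_close[OF \<mu> \<nu> x] by metis
  have p_ac: "ac_on 0 tf p" and p_tf: "p tf = 0"
    using p by (auto simp: is_costate_trajectory_def)
  have p_cont: "continuous_on {0..tf} p"
    by (rule ac_on_continuous_on[OF p_ac])
  obtain P where P: "0 \<le> P" "\<And>t. t \<in> {0..tf} \<Longrightarrow> norm (p t) \<le> P"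
    using compact_continuous_norm_bound[OF compact_Icc p_cont] by metis
  obtain C where C: "0 \<le> C"
    "\<And>m n l x y q. m \<in> prob_measures_on U \<Longrightarrow> n \<in> prob_measures_on U \<Longrightarrow> 0 \<le> l \<Longrightarrow>
       x \<in> cball 0 R \<Longrightarrow> y \<in> cball 0 R \<Longrightarrow> norm q \<le> P \<Longrightarrow>
       \<bar>defect m n l x y q\<bar> \<le> C * ((norm (y - x))\<^sup>2 + l * norm (y - x))"
    using defect_le[OF P(1)] by metis
  have x_ac: "ac_on 0 tf x" and x_start: "x 0 = x0"
    using x by (auto simp: is_state_trajectory_def)
  have running_int: "((\<lambda>t. \<integral>u. L (y t) u \<partial>m t) has_integral
      (\<integral>t. (\<integral>u. L (y t) u \<partial>m t) \<partial>lebesgue_on {0..tf})) {0..tf}"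
    if "relaxed_control U tf m" "continuous_on {0..tf} y" for m y
    by (rule has_integral_integral_lebesgue_on[OF relaxed_integral_integrable[OF that(1) compact_U
        less_imp_le[OF tf_pos] continuous_along_curve[OF L_continuous that(2)]]]) simp
  have ham_int: "integrable (lebesgue_on {0..tf}) (\<lambda>t. hamiltonian f L (x t) (m t) (p t))"
    if "relaxed_control U tf m" for m
    unfolding hamiltonian_def
  proof (rule relaxed_integral_integrable[OF that compact_U])
    have "continuous_on ({0..tf} \<times> U) (\<lambda>z. p (fst z))"
      by (rule continuous_on_compose2[OF p_cont]) (auto intro: continuous_intros)
    then show "continuous_on ({0..tf} \<times> U) (\<lambda>(t, u). p t \<bullet> f (x t) u + L (x t) u)"
      using continuous_along_curve[OF f_continuous ac_on_continuous_on[OF x_ac]]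
        continuous_along_curve[OF L_continuous ac_on_continuous_on[OF x_ac]]
      unfolding case_prod_unfold by (intro continuous_intros)
  qed (use tf_pos in simp)
  define I where "I = (\<integral>t. hamiltonian f L (x t) (\<nu> t) (p t) - hamiltonian f L (x t) (\<mu> t) (p t)
      \<partial>lebesgue_on {0..tf})"
  have I: "((\<lambda>t. hamiltonian f L (x t) (\<nu> t) (p t) - hamiltonian f L (x t) (\<mu> t) (p t)) has_integral I) {0..tf}"
    unfolding I_def
    by (intro has_integral_integral_lebesgue_on Bochner_Integration.integrable_diff ham_int \<mu> \<nu>) simp
  \<comment> \<open>The value at \<open>l = 0\<close> is expressed through the given \<open>x\<close>, since the trajectory chosen for the
      mixture with \<open>l = 0\<close> need only agree with \<open>x\<close> on the time interval.\<close>
  define J0 where "J0 = (\<integral>t. (\<integral>u. L (x t) u \<partial>\<mu> t) \<partial>lebesgue_on {0..tf})"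
  have J0: "((\<lambda>t. \<integral>u. L (x t) u \<partial>\<mu> t) has_integral J0) {0..tf}"
    unfolding J0_def by (rule running_int[OF \<mu> state_trajectory_continuous[OF x]])
  have "\<bar>cost f L tf x0 (mix_control l \<nu> \<mu>) - J0 - l * I\<bar> \<le> (C * (B\<^sup>2 + B) * tf) * l\<^sup>2"
    if l: "0 \<le> l" "l \<le> 1" for l
  proof -
    have mix: "relaxed_control U tf (mix_control l \<nu> \<mu>)"
      by (rule relaxed_control_mix[OF \<mu> \<nu> compact_U l])
    define y where "y = state_trajectory f tf x0 (mix_control l \<nu> \<mu>)"
    have y: "is_state_trajectory f tf x0 (mix_control l \<nu> \<mu>) y"
      unfolding y_def by (rule is_state_trajectory_state_trajectory[OF mix])
    have y_ac: "ac_on 0 tf y" and y_start: "y 0 = x0"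
      using y by (auto simp: is_state_trajectory_def)
    define Q where "Q t = p t \<bullet> ((\<integral>u. f (y t) u \<partial>mix_control l \<nu> \<mu> t) - (\<integral>u. f (x t) u \<partial>\<mu> t))
      + - (\<integral>u. transpose (Dx f (x t) u) *v p t + gradx L (x t) u \<partial>\<mu> t) \<bullet> (y t - x t)" for t
    have "AE t in lebesgue_on {0..tf}. ((\<lambda>t. p t \<bullet> (y t - x t)) has_vector_derivative Q t) (at t within {0..tf})"
      using x[unfolded is_state_trajectory_def, THEN conjunct2, THEN conjunct2]
        y[unfolded is_state_trajectory_def, THEN conjunct2, THEN conjunct2]
        p[unfolded is_costate_trajectory_def, THEN conjunct2, THEN conjunct2]
      unfolding Q_def
      by eventually_elim
        (intro bounded_bilinear.has_vector_derivative[OF bounded_bilinear_inner] has_vector_derivative_diff)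
    then have "(Q has_integral (p tf \<bullet> (y tf - x tf) - p 0 \<bullet> (y 0 - x 0))) {0..tf}"
      using tf_pos by (intro ac_on_AE_has_integral[of 0 tf "\<lambda>t. p t \<bullet> (y t - x t)"] ac_on_inner ac_on_diff p_ac y_ac x_ac) auto
    then have Q: "(Q has_integral 0) {0..tf}"
      by (simp add: p_tf x_start y_start)
    have J: "((\<lambda>t. \<integral>u. L (y t) u \<partial>mix_control l \<nu> \<mu> t) has_integral cost f L tf x0 (mix_control l \<nu> \<mu>)) {0..tf}"
      unfolding cost_def y_def[symmetric] by (rule running_int[OF mix state_trajectory_continuous[OF y]])
    have "((\<lambda>t. (\<integral>u. L (y t) u \<partial>mix_control l \<nu> \<mu> t) - (\<integral>u. L (x t) u \<partial>\<mu> t)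
        - l * (hamiltonian f L (x t) (\<nu> t) (p t) - hamiltonian f L (x t) (\<mu> t) (p t)) + Q t)
      has_integral (cost f L tf x0 (mix_control l \<nu> \<mu>) - J0 - l * I + 0)) {0..tf}"
      by (intro has_integral_add has_integral_diff has_integral_mult_right J J0 I Q)
    then have "norm (cost f L tf x0 (mix_control l \<nu> \<mu>) - J0 - l * I + 0) \<le> C * (B\<^sup>2 + B) * l\<^sup>2 * (tf - 0)"
    proof (rule has_integral_norm_le_interval)
      fix t assume t: "t \<in> {0..tf}"
      have "norm ((\<integral>u. L (y t) u \<partial>mix_control l \<nu> \<mu> t) - (\<integral>u. L (x t) u \<partial>\<mu> t)
          - l * (hamiltonian f L (x t) (\<nu> t) (p t) - hamiltonian f L (x t) (\<mu> t) (p t)) + Q t)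
        = \<bar>defect (\<mu> t) (\<nu> t) l (x t) (y t) (p t)\<bar>"
        using integral_mix_control[OF \<mu> \<nu> l t continuous_on_slice[OF L_continuous], of "y t"]
          integral_mix_control[OF \<mu> \<nu> l t continuous_on_slice[OF f_continuous], of "y t"]
        by (simp add: defect_def Q_def)
      also have "\<dots> \<le> C * ((norm (y t - x t))\<^sup>2 + l * norm (y t - x t))"
        using R[OF \<mu> x t] R[OF mix y t] P(2)[OF t]
        by (intro C(2) relaxed_controlD[OF \<mu> t] relaxed_controlD[OF \<nu> t] l) auto
      also have "\<dots> \<le> C * ((B * l)\<^sup>2 + l * (B * l))"
        using B[OF l y t] C(1) l by (intro mult_left_mono add_mono power_mono) auto
      also have "\<dots> = C * (B\<^sup>2 + B) * l\<^sup>2"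
        by (simp add: power2_eq_square algebra_simps)
      finally show "norm ((\<integral>u. L (y t) u \<partial>mix_control l \<nu> \<mu> t) - (\<integral>u. L (x t) u \<partial>\<mu> t)
          - l * (hamiltonian f L (x t) (\<nu> t) (p t) - hamiltonian f L (x t) (\<mu> t) (p t)) + Q t)
        \<le> C * (B\<^sup>2 + B) * l\<^sup>2" .
    qed (use tf_pos in simp)
    then show ?thesis
      by (simp add: algebra_simps)
  qed
  then show thesis
    unfolding I_def by (rule that)
qed

end

theorem proposition3p1:
  fixes U :: "(real^'k) set"
    and f :: "real^'n \<Rightarrow> real^'k \<Rightarrow> real^'n"
    and L :: "real^'n \<Rightarrow> real^'k \<Rightarrow> real"
    and tf :: real and x0 :: "real^'n"
    and \<mu> \<nu> :: "real \<Rightarrow> (real^'k) measure"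
    and x p :: "real \<Rightarrow> real^'n"
  assumes "compact U" and "tf > 0"
    and "dynamics_assms U f" and "cost_assms U L"
    and "relaxed_control U tf \<mu>" and "relaxed_control U tf \<nu>"
    and "is_state_trajectory f tf x0 \<mu> x"
    and "is_costate_trajectory f L tf \<mu> x p"
  shows "((\<lambda>l. cost f L tf x0 (mix_control l \<nu> \<mu>)) has_real_derivative
           (\<integral>t. hamiltonian f L (x t) (\<nu> t) (p t) - hamiltonian f L (x t) (\<mu> t) (p t)
              \<partial>lebesgue_on {0..tf})) (at_right 0)"
proof -
  interpret relaxed_control_problem U f tf x0 L
    using assms(1-4) by unfold_locales
  show ?thesis
    by (rule cost_expansion[OF assms(5-8)]) (rule has_right_derivative_quadratic_remainder)
qed

end
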